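(* The following decision problem is solvable in polynomial time. Input: a finite set of $m$ candidates, a distinguished candidate $p$, a finite list of (complete or partial) votes of the non-manipulators, each with a positive integer weight, and a finite list of positive integer weights, one for each manipulator in a coalition. Question: can each manipulator in the coalition cast a (complete or partial) vote, counted with that manipulator's weight, such that $p$ wins the election under the rule Borda$_{\uparrow}$ applied to all the weighted votes?
   Context: A complete vote is a linear order over all $m$ candidates; a partial vote is a linear order over a strict subset of the candidates (the candidates in the subset are the ranked ones, in order of preference from 1st to $k$th; the others are unranked). A vote of integer weight $w$ is treated as $w$ identical unweighted votes; weights are given in binary. The Borda scores are $s_i = m-i$ for $i=1,\dots,m$; a complete vote gives its $i$th ranked candidate $s_i$ points. Under Borda$_{\uparrow}$ ("round up"), a partial vote ranking $k<m$ candidates gives $s_i$ points to its $i$th ranked candidate ($i\le k$) and $0$ points to every unranked candidate. The candidate with highest total score wins; ties are broken in favour of the manipulators, so $p$ wins iff its total score is at least that of every other candidate. The manipulators have complete knowledge of the other votes. *)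

theory Defs
  imports "HOL-Computational_Algebra.Polynomial"
begin

section \<open>Deterministic multi-tape Turing machines and polynomial time\<close>

text \<open>
  States and tape symbols are natural numbers, the symbol 0 being the blank. Tapes are infinite in
  both directions. A transition sees the current state and the list of symbols under the
  heads, and yields a new state together with, for every tape, a symbol to write and a head move.
\<close>

datatype move = Go_Left | Stay | Go_Right

record machine =
  tapes   :: nat
  symbols :: nat
  states  :: nat
  start   :: nat
  accept  :: nat
  reject  :: nat
  delta   :: "nat \<Rightarrow> nat list \<Rightarrow> nat \<times> (nat \<times> move) list"

text \<open>Well-formed machine whose input alphabet is \<open>{1..s}\<close>.\<close>

definition wf_machine :: "nat \<Rightarrow> machine \<Rightarrow> bool" where
  "wf_machine s M \<longleftrightarrow>
     tapes M \<ge> 1 \<and> s < symbols M \<and>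
     start M < states M \<and> accept M < states M \<and> reject M < states M \<and> accept M \<noteq> reject M \<and>
     (\<forall>q < states M. \<forall>rs. length rs = tapes M \<and> set rs \<subseteq> {..<symbols M} \<longrightarrow>
        (case delta M q rs of (q', as) \<Rightarrow>
           q' < states M \<and> length as = tapes M \<and> fst ` set as \<subseteq> {..<symbols M}))"

type_synonym tape = "(int \<Rightarrow> nat) \<times> int"
type_synonym config = "nat \<times> tape list"

fun read_head :: "tape \<Rightarrow> nat" where
  "read_head (f, h) = f h"

fun offset :: "move \<Rightarrow> int" where
  "offset Go_Left = -1"
| "offset Stay = 0"
| "offset Go_Right = 1"

fun act :: "nat \<times> move \<Rightarrow> tape \<Rightarrow> tape" where
  "act (a, d) (f, h) = (f(h := a), h + offset d)"

fun step :: "machine \<Rightarrow> config \<Rightarrow> config" where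
  "step M (q, ts) =
     (if q = accept M \<or> q = reject M then (q, ts)
      else case delta M q (map read_head ts) of (q', as) \<Rightarrow> (q', map2 act as ts))"

definition blank_tape :: tape where
  "blank_tape = ((\<lambda>_. 0), 0)"

definition input_tape :: "nat list \<Rightarrow> tape" where
  "input_tape w = ((\<lambda>i. if 0 \<le> i \<and> i < int (length w) then w ! nat i else 0), 0)"

definition initial :: "machine \<Rightarrow> nat list \<Rightarrow> config" where
  "initial M w = (start M, input_tape w # replicate (tapes M - 1) blank_tape)"

definition state_after :: "machine \<Rightarrow> nat list \<Rightarrow> nat \<Rightarrow> nat" where
  "state_after M w t = fst ((step M ^^ t) (initial M w))"

text \<open>
  Accepting and rejecting configurations are fixed points of \<^const>\<open>step\<close>, so the state
  reached after exactly \<open>T (length w)\<close> steps tells whether the machine has halted within that bound.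
\<close>

definition decides_in_time :: "nat \<Rightarrow> machine \<Rightarrow> (nat \<Rightarrow> nat) \<Rightarrow> nat list set \<Rightarrow> bool" where
  "decides_in_time s M T L \<longleftrightarrow>
     (\<forall>w \<in> lists {1..s}.
        state_after M w (T (length w)) = (if w \<in> L then accept M else reject M))"

text \<open>The class P of languages over the alphabet \<open>{1..s}\<close>.\<close>

definition polytime :: "nat \<Rightarrow> nat list set set" where
  "polytime s =
     {L. L \<subseteq> lists {1..s} \<and>
         (\<exists>M (q :: nat poly). wf_machine s M \<and> decides_in_time s M (poly q) L)}"


section \<open>Elections under Borda with rounding up\<close>

text \<open>
  Candidates are named by bit strings. A vote lists its ranked candidates in order of
  preference; it is complete if it ranks all candidates and partial otherwise.
\<close>

type_synonym candidate = "bool list"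
type_synonym vote = "candidate list"

definition is_vote :: "candidate set \<Rightarrow> vote \<Rightarrow> bool" where
  "is_vote C v \<longleftrightarrow> distinct v \<and> set v \<subseteq> C"

definition borda :: "nat \<Rightarrow> nat \<Rightarrow> nat" where
  "borda m i = m - i"

definition rank :: "vote \<Rightarrow> candidate \<Rightarrow> nat" where
  "rank v c = length (takeWhile (\<lambda>d. d \<noteq> c) v) + 1"

definition points_up :: "candidate set \<Rightarrow> vote \<Rightarrow> candidate \<Rightarrow> nat" where
  "points_up C v c = (if c \<in> set v then borda (card C) (rank v c) else 0)"

definition unweighted :: "(nat \<times> vote) list \<Rightarrow> vote list" where
  "unweighted vs = concat (map (\<lambda>(w, v). replicate w v) vs)"

definition score_up :: "candidate set \<Rightarrow> (nat \<times> vote) list \<Rightarrow> candidate \<Rightarrow> nat" where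
  "score_up C vs c = (\<Sum>v\<leftarrow>unweighted vs. points_up C v c)"

definition wins_up :: "candidate set \<Rightarrow> (nat \<times> vote) list \<Rightarrow> candidate \<Rightarrow> bool" where
  "wins_up C vs p \<longleftrightarrow> (\<forall>c \<in> C. score_up C vs c \<le> score_up C vs p)"


section \<open>The weighted coalitional manipulation problem\<close>

record manip_instance =
  cands      :: "candidate list"
  favourite  :: candidate
  votes      :: "(nat \<times> vote) list"
  coalition  :: "nat list"

definition valid_instance :: "manip_instance \<Rightarrow> bool" where
  "valid_instance I \<longleftrightarrow>
     distinct (cands I) \<and> favourite I \<in> set (cands I) \<and>
     (\<forall>(w, v) \<in> set (votes I). w > 0 \<and> is_vote (set (cands I)) v) \<and>
     (\<forall>w \<in> set (coalition I). w > 0)"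

definition manipulable_up :: "manip_instance \<Rightarrow> bool" where
  "manipulable_up I \<longleftrightarrow>
     (\<exists>vs. length vs = length (coalition I) \<and>
           (\<forall>v \<in> set vs. is_vote (set (cands I)) v) \<and>
           wins_up (set (cands I)) (votes I @ zip (coalition I) vs) (favourite I))"

text \<open>
  Instances are written as words over \<open>{1..5}\<close>: 1 and 2 are the bits 0 and 1, 3 ends a bit string,
  4 and 5 are opening and closing list brackets. Weights are in binary, least significant bit
  first and without leading zeros.
\<close>

fun binary :: "nat \<Rightarrow> bool list" where
  "binary n = (if n = 0 then [] else odd n # binary (n div 2))"

declare binary.simps [simp del]

definition enc_bits :: "bool list \<Rightarrow> nat list" where
  "enc_bits bs = map (\<lambda>b. if b then 2 else 1) bs @ [3]"

definition enc_nat :: "nat \<Rightarrow> nat list" where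
  "enc_nat n = enc_bits (binary n)"

definition enc_list :: "('a \<Rightarrow> nat list) \<Rightarrow> 'a list \<Rightarrow> nat list" where
  "enc_list e xs = 4 # concat (map e xs) @ [5]"

definition enc_vote :: "nat \<times> vote \<Rightarrow> nat list" where
  "enc_vote = (\<lambda>(w, v). enc_nat w @ enc_list enc_bits v)"

definition encode :: "manip_instance \<Rightarrow> nat list" where
  "encode I =
     enc_list enc_bits (cands I) @ enc_bits (favourite I) @
     enc_list enc_vote (votes I) @ enc_list enc_nat (coalition I)"

definition borda_up_manipulation :: "nat list set" where
  "borda_up_manipulation = {encode I | I. valid_instance I \<and> manipulable_up I}"

lemma binary_inject: "binary m = binary n \<longleftrightarrow> m = n"
proof
  show "binary m = binary n \<Longrightarrow> m = n"
  proof (induction m arbitrary: n rule: less_induct)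
    case (less m)
    show ?case
    proof (cases "m = 0 \<or> n = 0")
      case True
      then show ?thesis using less.prems by (auto simp: binary.simps[of m] binary.simps[of n] split: if_splits)
    next
      case False
      then have *: "odd m = odd n" "binary (m div 2) = binary (n div 2)"
        using less.prems by (auto simp: binary.simps[of m] binary.simps[of n])
      then have "m div 2 = n div 2" using less.IH[of "m div 2"] False by auto
      moreover have "m mod 2 = n mod 2" using *(1) by presburger
      ultimately show ?thesis by (metis div_mult_mod_eq)
    qed
  qed
qed simp

lemma enc_bits_prefix: "enc_bits x @ r = enc_bits y @ s \<longleftrightarrow> x = y \<and> r = s"
proof (induction x arbitrary: y)
  case Nil
  show ?case by (cases y) (auto simp: enc_bits_def)
next
  case (Cons b x)
  show ?case
  proof (cases y)
    case Nil
    then show ?thesis by (auto simp: enc_bits_def)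
  next
    case (Cons c z)
    then show ?thesis using Cons.IH[of z] by (auto simp: enc_bits_def split: if_splits)
  qed
qed

lemma enc_nat_prefix: "enc_nat x @ r = enc_nat y @ s \<longleftrightarrow> x = y \<and> r = s"
  by (simp add: enc_nat_def enc_bits_prefix binary_inject)

lemma enc_list_prefix:
  assumes e: "\<And>x y r s. e x @ r = e y @ s \<longleftrightarrow> x = y \<and> r = s"
    and ne: "\<And>x r s. e x @ r \<noteq> 5 # s"
  shows "enc_list e xs @ r = enc_list e ys @ s \<longleftrightarrow> xs = ys \<and> r = s"
proof (induction xs arbitrary: ys)
  case Nil
  show ?case using ne[THEN not_sym] by (cases ys) (auto simp: enc_list_def)
next
  case (Cons x xs)
  show ?case
  proof (cases ys)
    case Nil
    then show ?thesis using ne by (auto simp: enc_list_def)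
  next
    case (Cons y zs)
    then show ?thesis using Cons.IH[of zs] by (auto simp: enc_list_def e)
  qed
qed

lemma enc_bits_neq: "enc_bits x @ r \<noteq> 5 # s"
  by (cases x) (auto simp: enc_bits_def)

lemmas enc_cands_prefix = enc_list_prefix[of enc_bits, OF enc_bits_prefix enc_bits_neq]

lemma enc_vote_prefix: "enc_vote x @ r = enc_vote y @ s \<longleftrightarrow> x = y \<and> r = s"
  by (cases x; cases y) (auto simp: enc_vote_def enc_nat_prefix enc_cands_prefix)

lemma enc_vote_neq: "enc_vote x @ r \<noteq> 5 # s"
  by (cases x) (auto simp: enc_vote_def enc_nat_def enc_bits_neq)

lemma enc_nat_neq: "enc_nat x @ r \<noteq> 5 # s"
  by (simp add: enc_nat_def enc_bits_neq)

lemma encode_inject: "encode I = encode J \<longleftrightarrow> I = J"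
proof
  assume "encode I = encode J"
  then have "encode I @ [] = encode J @ []" by simp
  then show "I = J"
    by (simp add: encode_def enc_bits_prefix enc_cands_prefix
        enc_list_prefix[of enc_vote, OF enc_vote_prefix enc_vote_neq]
        enc_list_prefix[of enc_nat _ "[]" _ "[]", OF enc_nat_prefix enc_nat_neq, simplified])
qed simp

lemma encode_mem_iff:
  "encode I \<in> borda_up_manipulation \<longleftrightarrow> valid_instance I \<and> manipulable_up I"
  by (auto simp: borda_up_manipulation_def encode_inject)

end

theory Submission imports Defs begin

text \<open>
  Under rounding up it is optimal for every manipulator to rank only \<open>p\<close>: this gives \<open>p\<close> the maximal
  \<open>m - 1\<close> points and nobody else any. So a coalition of total weight \<open>W\<close> succeeds iff the score of
  every candidate from the given votes exceeds that of \<open>p\<close> by at most \<open>W (m - 1)\<close>. Since the points of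
  a single vote are at most \<open>m - 1\<close>, they are counted in unary, and multiplying by a binary weight
  is repeated addition.

  The Turing machine is obtained from a program over finitely many stacks, one per tape. Its states
  are the residual programs of a small-step semantics, of which there are finitely many. The
  semantics caps the number of iterations of each loop by a parameter \<open>N\<close>, so the running time is
  bounded by a polynomial in \<open>N\<close> that depends on the program text alone, and only iteration counts
  have to be estimated.
\<close>

section \<open>Stack programs and Turing machines\<close>

text \<open>A program can test a stack for emptiness only by seeing a blank on top, so all data is
  kept free of \<open>0\<close>. Every loop, however deeply nested, gets the same cap
  \<open>N\<close>; the degree of the time bound is therefore the loop nesting depth of the fixed
  program.

  A failed validity check does not stop the program. It only sets a flag, and the scores are
  computed regardless. The iteration bounds must hence hold for every syntactically correct word,
  including votes that repeat names or are longer than the list of candidates. For these the points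
  of one vote are bounded only by a product of two lengths, whence the quadratic cap
  \<open>N = 1 + n + n * n\<close> for inputs of length \<open>n\<close>.

  Words that encode nothing have to be rejected too. A finite automaton recognises precisely the
  encodings of instances with positive weights; injectivity of \<open>encode\<close> then turns
  membership of a word in the language into a property of a single instance.\<close>

declare One_nat_def [simp del]

type_synonym state = "nat \<Rightarrow> nat list"

definition hd0 :: "nat list \<Rightarrow> nat" where
  "hd0 xs = (case xs of [] \<Rightarrow> 0 | x # _ \<Rightarrow> x)"

lemma hd0_simps [simp]: "hd0 [] = 0" "hd0 (x # xs) = x"
  by (simp_all add: hd0_def)

definition tops :: "state \<Rightarrow> nat \<Rightarrow> nat" where
  "tops s = (\<lambda>r. hd0 (s r))"

lemma tops_apply: "tops s r = hd0 (s r)"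
  by (simp add: tops_def)

text \<open>A push is a \<open>Shift\<close>, which pushes a blank, followed by a \<open>Put\<close> that overwrites it: a head
  writes before it moves.\<close>

datatype com =
    Skip
  | Pop nat
  | Shift nat
  | Put nat "(nat \<Rightarrow> nat) \<Rightarrow> nat"
  | Seq com com (infixr ";;" 60)
  | Test "(nat \<Rightarrow> nat) \<Rightarrow> bool" com com
  | Loop "(nat \<Rightarrow> nat) \<Rightarrow> bool" com

text \<open>Running out of the \<open>N\<close> permitted iterations yields \<^const>\<open>None\<close>.\<close>

fun iter ::
  "nat \<Rightarrow> (state \<Rightarrow> bool) \<Rightarrow> (state \<Rightarrow> state option) \<Rightarrow> state \<Rightarrow> state option" where
  "iter 0 b f s = (if b s then None else Some s)"
| "iter (Suc k) b f s = (if b s then Option.bind (f s) (iter k b f) else Some s)"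

primrec run :: "nat \<Rightarrow> com \<Rightarrow> state \<Rightarrow> state option" where
  "run N Skip = Some"
| "run N (Pop r) = (\<lambda>s. Some (s(r := tl (s r))))"
| "run N (Shift r) = (\<lambda>s. Some (s(r := 0 # s r)))"
| "run N (Put r f) = (\<lambda>s. Some (s(r := f (tops s) # tl (s r))))"
| "run N (c ;; d) = (\<lambda>s. Option.bind (run N c s) (run N d))"
| "run N (Test P c d) = (\<lambda>s. if P (tops s) then run N c s else run N d s)"
| "run N (Loop P c) = iter N (\<lambda>s. P (tops s)) (run N c)"

text \<open>\<open>Test\<close> is charged for both branches, as their sum bounds either. An
  iteration costs two silent steps besides the body, one to unfold the loop and one to drop the
  \<open>Skip\<close> left by the body; the last \<open>1\<close> is the failing test.
  \<open>[:0, 1:]\<close> is the indeterminate, to be evaluated at \<open>N\<close>.\<close>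

primrec time_bound :: "com \<Rightarrow> nat poly" where
  "time_bound Skip = 0"
| "time_bound (Pop r) = 1"
| "time_bound (Shift r) = 1"
| "time_bound (Put r f) = 1"
| "time_bound (c ;; d) = time_bound c + time_bound d + 1"
| "time_bound (Test P c d) = time_bound c + time_bound d + 1"
| "time_bound (Loop P c) = [:0, 1:] * (time_bound c + 2) + 1"

definition symbol_fun :: "nat \<Rightarrow> ((nat \<Rightarrow> nat) \<Rightarrow> nat) \<Rightarrow> bool" where
  "symbol_fun S f \<longleftrightarrow> (\<forall>t. (\<forall>i. t i < S) \<longrightarrow> f t < S)"

primrec wf_com :: "nat \<Rightarrow> nat \<Rightarrow> com \<Rightarrow> bool" where
  "wf_com K S Skip = True"
| "wf_com K S (Pop r) = (r < K)"
| "wf_com K S (Shift r) = (r < K)"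
| "wf_com K S (Put r f) = (r < K \<and> symbol_fun S f)"
| "wf_com K S (c ;; d) = (wf_com K S c \<and> wf_com K S d)"
| "wf_com K S (Test P c d) = (wf_com K S c \<and> wf_com K S d)"
| "wf_com K S (Loop P c) = wf_com K S c"

text \<open>\<open>Pop\<close> erases the cell it leaves, because everything left of the head must
  stay blank. \<open>Shift\<close> writes back the symbol it read and exposes the blank cell to the
  left. Tests and sequencing give \<open>None\<close>, a step that changes no tape.\<close>

primrec next_com :: "com \<Rightarrow> (nat \<Rightarrow> nat) \<Rightarrow> com \<times> (nat \<times> nat \<times> move) option" where
  "next_com Skip t = (Skip, None)"
| "next_com (Pop r) t = (Skip, Some (r, 0, Go_Right))"
| "next_com (Shift r) t = (Skip, Some (r, t r, Go_Left))"
| "next_com (Put r f) t = (Skip, Some (r, f t, Stay))"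
| "next_com (c ;; d) t =
     (if c = Skip then (d, None) else (fst (next_com c t) ;; d, snd (next_com c t)))"
| "next_com (Test P c d) t = (if P t then c else d, None)"
| "next_com (Loop P c) t = (if P t then c ;; Loop P c else Skip, None)"

text \<open>An over-approximation of what \<open>next_com\<close> can reach, finite by structure:
  unfolding a loop adds only residuals of its body followed by that same loop.\<close>

primrec residuals :: "com \<Rightarrow> com set" where
  "residuals Skip = {Skip}"
| "residuals (Pop r) = {Pop r, Skip}"
| "residuals (Shift r) = {Shift r, Skip}"
| "residuals (Put r f) = {Put r f, Skip}"
| "residuals (c ;; d) = (\<lambda>c'. c' ;; d) ` residuals c \<union> residuals d"
| "residuals (Test P c d) = {Test P c d} \<union> residuals c \<union> residuals d"
| "residuals (Loop P c) = {Loop P c, Skip} \<union> (\<lambda>c'. c' ;; Loop P c) ` residuals c"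

lemma finite_residuals: "finite (residuals c)"
  by (induction c) auto

lemma self_in_residuals: "c \<in> residuals c"
  by (induction c) auto

lemma Skip_in_residuals: "Skip \<in> residuals c"
  by (induction c) auto

text \<open>This closure is what allows the residuals to serve as the states of a machine.\<close>

lemma next_com_residuals: "c' \<in> residuals c \<Longrightarrow> fst (next_com c' t) \<in> residuals c"
proof (induction c arbitrary: c')
  case (Seq c d)
  then show ?case by (auto simp: self_in_residuals)
next
  case (Test P c d)
  then show ?case by (auto simp: self_in_residuals)
next
  case (Loop P c)
  then show ?case by (auto simp: self_in_residuals split: if_splits)
qed auto

lemma residuals_wf: "wf_com K S c \<Longrightarrow> c' \<in> residuals c \<Longrightarrow> wf_com K S c'"
proof (induction c arbitrary: c')
  case (Seq c d)
  from Seq.prems show ?case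
    by (simp only: residuals.simps wf_com.simps Un_iff image_iff) (metis Seq.IH wf_com.simps(5))
next
  case (Test P c d)
  from Test.prems show ?case
    by (simp only: residuals.simps wf_com.simps Un_iff insert_iff empty_iff)
      (metis Test.IH wf_com.simps(6))
next
  case (Loop P c)
  from Loop.prems show ?case
    by (simp only: residuals.simps wf_com.simps Un_iff insert_iff empty_iff image_iff)
      (metis Loop.IH wf_com.simps)
next
  case (Put r f)
  then show ?case by fastforce
next
  case (Pop r)
  then show ?case by fastforce
next
  case (Shift r)
  then show ?case by fastforce
next
  case Skip
  then show ?case by fastforce
qed

lemma next_com_action_wf:
  assumes "\<forall>i. t i < S" "0 < S"
  shows "wf_com K S c \<Longrightarrow> snd (next_com c t) = Some (r, a, d) \<Longrightarrow> r < K \<and> a < S"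
proof (induction c)
  case (Put q f)
  then have "symbol_fun S f" by simp
  then have "f t < S" using assms(1) unfolding symbol_fun_def by blast
  then show ?case using Put by auto
qed (use assms in \<open>auto split: if_splits\<close>)

section \<open>Simulating small steps on tapes\<close>

definition actions :: "nat \<Rightarrow> (nat \<times> nat \<times> move) option \<Rightarrow> nat list \<Rightarrow> (nat \<times> move) list" where
  "actions K x rs =
     map (\<lambda>i. case x of None \<Rightarrow> (rs ! i, Stay)
                      | Some (r, a, d) \<Rightarrow> if i = r then (a, d) else (rs ! i, Stay)) [0..<K]"

lemma length_actions [simp]: "length (actions K x rs) = K"
  by (simp add: actions_def)

text \<open>The default \<open>0\<close> beyond the last tape matches \<open>represents\<close>,
  which demands empty stacks there. So \<open>look\<close> and \<open>tops\<close> agree as total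
  functions, and tests can be given either.\<close>

definition look :: "nat list \<Rightarrow> nat \<Rightarrow> nat" where
  "look rs = (\<lambda>i. if i < length rs then rs ! i else 0)"

definition com_step :: "nat \<Rightarrow> com \<times> tape list \<Rightarrow> com \<times> tape list \<Rightarrow> bool" where
  "com_step K x y \<longleftrightarrow> fst x \<noteq> Skip \<and>
     (let rs = map read_head (snd x); n = next_com (fst x) (look rs)
      in y = (fst n, map2 act (actions K (snd n) rs) (snd x)))"

text \<open>A step from \<open>c\<close> presupposes that \<open>c\<close> is not
  \<open>Skip\<close>, which is exactly the condition under which \<open>c ;; d\<close> steps in its
  first component.\<close>

lemma com_steps_Seq:
  "(com_step K ^^ k) (c, ts) (c', ts') \<Longrightarrow> (com_step K ^^ k) (c ;; d, ts) (c' ;; d, ts')"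
proof (induction k arbitrary: c' ts')
  case (Suc k)
  then obtain c'' ts'' where "(com_step K ^^ k) (c, ts) (c'', ts'')" "com_step K (c'', ts'') (c', ts')"
    by auto
  moreover have "com_step K (c'' ;; d, ts'') (c' ;; d, ts')"
    using \<open>com_step K (c'', ts'') (c', ts')\<close> by (auto simp: com_step_def Let_def)
  ultimately show ?case using Suc.IH by auto
qed simp

text \<open>The head is on the top of the stack, and the stack extends to the right; pushing moves left.\<close>

definition tape_of :: "nat list \<Rightarrow> tape \<Rightarrow> bool" where
  "tape_of xs T \<longleftrightarrow> (\<forall>i. fst T (snd T + i) = (if 0 \<le> i \<and> i < int (length xs) then xs ! nat i else 0))"

definition represents :: "nat \<Rightarrow> tape list \<Rightarrow> state \<Rightarrow> bool" where
  "represents K ts s \<longleftrightarrow> length ts = K \<and> (\<forall>r<K. tape_of (s r) (ts ! r)) \<and> (\<forall>r\<ge>K. s r = [])"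

lemma tape_of_read:
  assumes "tape_of xs T"
  shows "read_head T = hd0 xs"
  using spec[OF assms[unfolded tape_of_def], of 0] by (cases T; cases xs) simp_all

lemma tape_of_act_stay:
  assumes "tape_of xs T"
  shows "tape_of (a # tl xs) (act (a, Stay) T)"
  unfolding tape_of_def
proof
  fix i
  show "fst (act (a, Stay) T) (snd (act (a, Stay) T) + i) =
      (if 0 \<le> i \<and> i < int (length (a # tl xs)) then (a # tl xs) ! nat i else 0)"
    using spec[OF assms[unfolded tape_of_def], of i]
    by (cases T; cases xs) (auto simp: nth_Cons')
qed

lemma tape_of_act_same: "act (read_head T, Stay) T = T"
  by (cases T) auto

lemma tape_of_act_right: "tape_of xs T \<Longrightarrow> tape_of (tl xs) (act (0, Go_Right) T)"
  unfolding tape_of_def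
proof
  fix i assume *: "\<forall>i. fst T (snd T + i) = (if 0 \<le> i \<and> i < int (length xs) then xs ! nat i else 0)"
  show "fst (act (0, Go_Right) T) (snd (act (0, Go_Right) T) + i) =
      (if 0 \<le> i \<and> i < int (length (tl xs)) then tl xs ! nat i else 0)"
    using spec[OF *, of "i + 1"]
    by (cases T; cases xs) (auto simp: nth_Cons nat_add_distrib add_ac)
qed

lemma tape_of_act_left: "tape_of xs T \<Longrightarrow> tape_of (0 # xs) (act (hd0 xs, Go_Left) T)"
  unfolding tape_of_def
proof
  fix i assume *: "\<forall>i. fst T (snd T + i) = (if 0 \<le> i \<and> i < int (length xs) then xs ! nat i else 0)"
  show "fst (act (hd0 xs, Go_Left) T) (snd (act (hd0 xs, Go_Left) T) + i) =
      (if 0 \<le> i \<and> i < int (length (0 # xs)) then (0 # xs) ! nat i else 0)"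
  \<comment> \<open>Only the cell of the old top is written, and after the move it has index 1. All
    other cells keep their contents, including the blank one now under the head.\<close>
  proof (cases "i = 1")
    case True
    then show ?thesis using spec[OF *, of 0] by (cases T; cases xs) auto
  next
    case False
    then have "fst (act (hd0 xs, Go_Left) T) (snd (act (hd0 xs, Go_Left) T) + i) = fst T (snd T + (i - 1))"
      by (cases T) (auto simp: algebra_simps)
    then show ?thesis using spec[OF *, of "i - 1"] False
      by (auto simp: nth_Cons' nat_diff_distrib One_nat_def)
  qed
qed

lemma look_represents: "represents K ts s \<Longrightarrow> look (map read_head ts) = tops s"
  by (auto simp: look_def represents_def fun_eq_iff tape_of_read tops_apply)

lemma actions_None:
  "length ts = K \<Longrightarrow> map2 act (actions K None (map read_head ts)) ts = ts"
  by (rule nth_equalityI) (auto simp: actions_def tape_of_act_same)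

lemma represents_actions_Some:
  assumes "represents K ts s" "r < K" "tape_of xs (act (a, d) (ts ! r))"
  shows "represents K (map2 act (actions K (Some (r, a, d)) (map read_head ts)) ts) (s(r := xs))"
  using assms by (auto simp: represents_def actions_def tape_of_act_same)

lemma com_step_silent:
  assumes "represents K ts s" "c \<noteq> Skip" "next_com c (tops s) = (c', None)"
  shows "com_step K (c, ts) (c', ts)"
  using assms by (auto simp: com_step_def Let_def look_represents actions_None represents_def)

definition reaches :: "nat \<Rightarrow> nat \<Rightarrow> com \<Rightarrow> tape list \<Rightarrow> com \<Rightarrow> state \<Rightarrow> bool" where
  "reaches K n c ts c' s' \<longleftrightarrow>
     (\<exists>k ts'. k \<le> n \<and> (com_step K ^^ k) (c, ts) (c', ts') \<and> represents K ts' s')"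

lemma reaches_silent:
  assumes "represents K ts s" "c \<noteq> Skip" "next_com c (tops s) = (c', None)"
    "reaches K n c' ts d s'"
  shows "reaches K (Suc n) c ts d s'"
proof -
  obtain k ts' where k: "k \<le> n" "(com_step K ^^ k) (c', ts) (d, ts')" "represents K ts' s'"
    using assms(4) by (auto simp: reaches_def)
  have "(com_step K ^^ Suc k) (c, ts) (d, ts')"
    by (rule relpowp_Suc_I2[OF com_step_silent[OF assms(1-3)] k(2)])
  then show ?thesis using k(1,3) unfolding reaches_def
    by (intro exI[of _ "Suc k"] exI[of _ ts']) simp
qed

text \<open>The \<open>Suc\<close> pays for the silent step from \<open>Skip ;; d\<close> to
  \<open>d\<close>.\<close>

lemma reaches_Seq:
  assumes "reaches K m c ts Skip s'"
    "\<And>ts'. represents K ts' s' \<Longrightarrow> reaches K n d ts' d' s''"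
  shows "reaches K (m + Suc n) (c ;; d) ts d' s''"
proof -
  obtain k ts' where k: "k \<le> m" "(com_step K ^^ k) (c, ts) (Skip, ts')" "represents K ts' s'"
    using assms(1) by (auto simp: reaches_def)
  have "reaches K (Suc n) (Skip ;; d) ts' d' s''"
    by (rule reaches_silent[OF k(3)]) (use assms(2) k(3) in auto)
  then obtain l ts'' where l: "l \<le> Suc n" "(com_step K ^^ l) (Skip ;; d, ts') (d', ts'')"
      "represents K ts'' s''"
    by (auto simp: reaches_def)
  have "(com_step K ^^ (k + l)) (c ;; d, ts) (d', ts'')"
    using com_steps_Seq[OF k(2)] l(2) by (auto simp: relpowp_add)
  then show ?thesis using k(1) l(1,3) unfolding reaches_def
    by (intro exI[of _ "k + l"] exI[of _ ts'']) simp
qed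

lemma reaches_mono: "reaches K m c ts d s \<Longrightarrow> m \<le> n \<Longrightarrow> reaches K n c ts d s"
  unfolding reaches_def by (blast intro: le_trans)

lemma reaches_action:
  assumes "represents K ts s" "c \<noteq> Skip" "r < K" "next_com c (tops s) = (Skip, Some (r, a, d))"
    "tape_of xs (act (a, d) (ts ! r))"
  shows "reaches K 1 c ts Skip (s(r := xs))"
proof -
  have "com_step K (c, ts) (Skip, map2 act (actions K (Some (r, a, d)) (map read_head ts)) ts)"
    using assms by (auto simp: com_step_def Let_def look_represents)
  then have "(com_step K ^^ 1) (c, ts) (Skip, map2 act (actions K (Some (r, a, d)) (map read_head ts)) ts)"
    by simp
  then show ?thesis
    using represents_actions_Some[OF assms(1,3,5)] unfolding reaches_def by blast
qed

lemma reaches_iter: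
  assumes body: "\<And>s s' ts. run N c s = Some s' \<Longrightarrow> represents K ts s \<Longrightarrow> reaches K B c ts Skip s'"
  shows "iter k (\<lambda>s. P (tops s)) (run N c) s = Some s' \<Longrightarrow> represents K ts s \<Longrightarrow>
    reaches K (k * (B + 2) + 1) (Loop P c) ts Skip s'"
proof (induction k arbitrary: s ts)
  case 0
  then have *: "\<not> P (tops s)" "s' = s" by (simp_all split: if_splits)
  have "reaches K 0 Skip ts Skip s'" using 0 * by (auto simp: reaches_def)
  then have "reaches K (Suc 0) (Loop P c) ts Skip s'"
    by (intro reaches_silent[OF 0(2)]) (simp_all add: *)
  then show ?case by (rule reaches_mono) auto
next
  case (Suc k)
  show ?case
  proof (cases "P (tops s)")
    case True
    then obtain s1 where s1: "run N c s = Some s1" "iter k (\<lambda>s. P (tops s)) (run N c) s1 = Some s'"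
      using Suc.prems(1) by (auto simp: bind_eq_Some_conv)
    have "reaches K (B + Suc (k * (B + 2) + 1)) (c ;; Loop P c) ts Skip s'"
      by (rule reaches_Seq[OF body[OF s1(1) Suc.prems(2)]]) (rule Suc.IH[OF s1(2)])
    then have "reaches K (Suc (B + Suc (k * (B + 2) + 1))) (Loop P c) ts Skip s'"
      by (intro reaches_silent[OF Suc.prems(2)]) (auto simp: True)
    then show ?thesis by (rule reaches_mono) auto
  next
    case False
    then have "reaches K 0 Skip ts Skip s'" using Suc.prems by (auto simp: reaches_def)
    then have "reaches K (Suc 0) (Loop P c) ts Skip s'"
      by (intro reaches_silent[OF Suc.prems(2)]) (auto simp: False)
    then show ?thesis by (rule reaches_mono) auto
  qed
qed

lemma reaches_run:
  assumes "run N c s = Some s'" "wf_com K S c" "represents K ts s"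
  shows "reaches K (poly (time_bound c) N) c ts Skip s'"
  using assms
proof (induction c arbitrary: s s' ts)
  case Skip
  then show ?case by (auto simp: reaches_def)
next
  case (Pop r)
  have "tape_of (tl (s r)) (act (0, Go_Right) (ts ! r))"
    using Pop by (auto intro!: tape_of_act_right simp: represents_def)
  moreover have "s' = s(r := tl (s r))" "r < K" using Pop by simp_all
  ultimately show ?case
    using reaches_action[OF Pop(3), of "Pop r" r 0 Go_Right "tl (s r)"]
    by (simp del: fun_upd_apply)
next
  case (Shift r)
  have "tape_of (0 # s r) (act (hd0 (s r), Go_Left) (ts ! r))"
    using Shift by (auto intro!: tape_of_act_left simp: represents_def)
  moreover have "s' = s(r := 0 # s r)" "r < K" using Shift by simp_all
  ultimately show ?case
    using reaches_action[OF Shift(3), of "Shift r" r "hd0 (s r)" Go_Left "0 # s r"]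
    by (simp add: tops_apply del: fun_upd_apply)
next
  case (Put r f)
  have "tape_of (f (tops s) # tl (s r)) (act (f (tops s), Stay) (ts ! r))"
    using Put by (auto intro!: tape_of_act_stay simp: represents_def)
  moreover have "s' = s(r := f (tops s) # tl (s r))" "r < K" using Put by simp_all
  ultimately show ?case
    using reaches_action[OF Put(3), of "Put r f" r "f (tops s)" Stay "f (tops s) # tl (s r)"]
    by (simp del: fun_upd_apply)
next
  case (Seq c d)
  then obtain s1 where s1: "run N c s = Some s1" "run N d s1 = Some s'"
    by (auto simp: bind_eq_Some_conv)
  have "reaches K (poly (time_bound c) N + Suc (poly (time_bound d) N)) (c ;; d) ts Skip s'"
    using Seq s1 by (intro reaches_Seq[of _ _ _ _ s1]) auto
  then show ?case by (rule reaches_mono) auto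
next
  case (Test P c d)
  show ?case
  proof (cases "P (tops s)")
    case True
    then have "reaches K (Suc (poly (time_bound c) N)) (Test P c d) ts Skip s'"
      using Test by (intro reaches_silent[OF Test.prems(3)]) auto
    then show ?thesis by (rule reaches_mono) auto
  next
    case False
    then have "reaches K (Suc (poly (time_bound d) N)) (Test P c d) ts Skip s'"
      using Test by (intro reaches_silent[OF Test.prems(3)]) auto
    then show ?thesis by (rule reaches_mono) auto
  qed
next
  case (Loop P c)
  have "reaches K (N * (poly (time_bound c) N + 2) + 1) (Loop P c) ts Skip s'"
    using Loop by (intro reaches_iter[of N c]) auto
  then show ?case by simp
qed

text \<open>State \<open>e d\<close> stands for the residual \<open>d\<close>; the next two numbers
  are the halting states. At \<open>Skip\<close> the top of tape \<open>R\<close> gives the verdict,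
  a blank meaning acceptance. The last branch provides the legal value that
  \<open>wf_machine\<close> demands of \<open>delta\<close> in halting states as well.\<close>

definition com_machine :: "nat \<Rightarrow> nat \<Rightarrow> nat \<Rightarrow> com \<Rightarrow> (com \<Rightarrow> nat) \<Rightarrow> machine" where
  "com_machine K S R c e = (let n = card (residuals c) in
     \<lparr>tapes = K, symbols = S, states = n + 2, start = e c, accept = n, reject = n + 1,
      delta = (\<lambda>q rs. if q < n then
          let d = inv_into (residuals c) e q; x = next_com d (look rs) in
          if d = Skip then (if look rs R = 0 then n else n + 1, actions K None rs)
          else (e (fst x), actions K (snd x) rs)
        else (n, actions K None rs))\<rparr>)"

lemma actions_wf:
  assumes "length rs = K" "set rs \<subseteq> {..<S}" "\<And>r a d. x = Some (r, a, d) \<Longrightarrow> a < S"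
  shows "fst ` set (actions K x rs) \<subseteq> {..<S}"
  using assms(1) assms(3) subsetD[OF assms(2) nth_mem]
  by (auto simp: actions_def split: option.splits)

section \<open>Correctness of the machine of a program\<close>

context
  fixes K S R :: nat and c :: com and e :: "com \<Rightarrow> nat"
  assumes e: "bij_betw e (residuals c) {0..<card (residuals c)}"
    and wf: "wf_com K S c" and S: "0 < S" and K: "0 < K"
begin

lemma e_less: "d \<in> residuals c \<Longrightarrow> e d < card (residuals c)"
  using e by (auto simp: bij_betw_def)

lemma inv_e: "d \<in> residuals c \<Longrightarrow> inv_into (residuals c) e (e d) = d"
  using e by (auto simp: bij_betw_def)

lemma inv_e_mem: "q < card (residuals c) \<Longrightarrow> inv_into (residuals c) e q \<in> residuals c"
  using e by (metis atLeastLessThan_iff bij_betw_def inv_into_into zero_le)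

lemma wf_com_machine:
  assumes "s < S"
  shows "wf_machine s (com_machine K S R c e)"
proof -
  have "case delta (com_machine K S R c e) q rs of (q', as) \<Rightarrow>
           q' < states (com_machine K S R c e) \<and> length as = tapes (com_machine K S R c e) \<and> fst ` set as \<subseteq> {..<symbols (com_machine K S R c e)}"
    if rs: "length rs = K" "set rs \<subseteq> {..<S}" for q rs
  proof (cases "q < card (residuals c)")
    case True
    define d where "d = inv_into (residuals c) e q"
    have d: "d \<in> residuals c" unfolding d_def by (rule inv_e_mem[OF True])
    have "\<forall>i. look rs i < S" using rs S by (auto simp: look_def dest: nth_mem)
    then have "fst ` set (actions K (snd (next_com d (look rs))) rs) \<subseteq> {..<S}"
      using next_com_action_wf[OF _ S residuals_wf[OF wf d]] by (intro actions_wf[OF rs]) blast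
    moreover have "fst ` set (actions K None rs) \<subseteq> {..<S}"
      by (rule actions_wf[OF rs]) simp
    moreover have "e (fst (next_com d (look rs))) < card (residuals c)"
      by (rule e_less[OF next_com_residuals[OF d]])
    ultimately show ?thesis
      using True by (simp add: com_machine_def Let_def d_def[symmetric])
  next
    case False
    have "fst ` set (actions K None rs) \<subseteq> {..<S}"
      by (rule actions_wf[OF rs]) simp
    then show ?thesis using False by (simp add: com_machine_def Let_def)
  qed
  then show ?thesis
    using assms K e_less[OF self_in_residuals]
    unfolding wf_machine_def by (simp add: com_machine_def Let_def)
qed

lemma machine_step:
  assumes "com_step K (d, ts) (d', ts')" "d \<in> residuals c"
  shows "step (com_machine K S R c e) (e d, ts) = (e d', ts')"
proof -
  have "e d < card (residuals c)" by (rule e_less[OF assms(2)])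
  then show ?thesis
    using assms(1) inv_e[OF assms(2)] unfolding com_step_def
    by (simp add: com_machine_def Let_def)
qed

lemma machine_steps:
  "(com_step K ^^ k) (d, ts) (d', ts') \<Longrightarrow> d \<in> residuals c \<Longrightarrow>
    (step (com_machine K S R c e) ^^ k) (e d, ts) = (e d', ts') \<and> d' \<in> residuals c"
proof (induction k arbitrary: d' ts')
  case (Suc k)
  then obtain d1 ts1 where 1: "(com_step K ^^ k) (d, ts) (d1, ts1)" "com_step K (d1, ts1) (d', ts')"
    by auto
  have 2: "(step (com_machine K S R c e) ^^ k) (e d, ts) = (e d1, ts1)" "d1 \<in> residuals c"
    using Suc.IH[OF 1(1) Suc.prems(2)] by auto
  have "d' = fst (next_com d1 (look (map read_head ts1)))"
    using 1(2) by (auto simp: com_step_def Let_def)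
  then have "d' \<in> residuals c" using next_com_residuals[OF 2(2)] by simp
  then show ?case using 2(1) machine_step[OF 1(2) 2(2)] by simp
qed simp

lemma machine_halts:
  assumes "represents K ts s"
  shows "fst (step (com_machine K S R c e) (e Skip, ts)) = (if hd0 (s R) = 0 then accept (com_machine K S R c e) else reject (com_machine K S R c e))"
proof -
  have "e Skip < card (residuals c)" by (rule e_less[OF Skip_in_residuals])
  then show ?thesis
    using inv_e[OF Skip_in_residuals] look_represents[OF assms]
    by (simp add: com_machine_def Let_def tops_apply)
qed

lemma step_halted: "q = accept (com_machine K S R c e) \<or> q = reject (com_machine K S R c e) \<Longrightarrow> (step (com_machine K S R c e) ^^ k) (q, ts) = (q, ts)"
  by (induction k) auto

lemma machine_state_after:
  assumes run: "run N c (\<lambda>r. if r = 0 then w else []) = Some s'"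
    and T: "poly (time_bound c) N < T"
  shows "state_after (com_machine K S R c e) w T = (if hd0 (s' R) = 0 then accept (com_machine K S R c e) else reject (com_machine K S R c e))"
proof -
  let ?ts = "input_tape w # replicate (K - 1) blank_tape"
  have rep: "represents K ?ts (\<lambda>r. if r = 0 then w else [])"
    using K by (simp add: represents_def tape_of_def input_tape_def blank_tape_def nth_Cons')
  obtain k ts' where k: "k \<le> poly (time_bound c) N" "(com_step K ^^ k) (c, ?ts) (Skip, ts')"
      "represents K ts' s'"
    using reaches_run[OF run wf rep] by (auto simp: reaches_def)
  have init: "initial (com_machine K S R c e) w = (e c, ?ts)"
    by (simp add: initial_def com_machine_def Let_def)
  have "(step (com_machine K S R c e) ^^ k) (initial (com_machine K S R c e) w) = (e Skip, ts')"
    using machine_steps[OF k(2) self_in_residuals] init by simp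
  then have 1: "(step (com_machine K S R c e) ^^ Suc k) (initial (com_machine K S R c e) w) = step (com_machine K S R c e) (e Skip, ts')" by simp
  \<comment> \<open>The strict bound \<open>T\<close> leaves room for the one step from
    \<open>Skip\<close> to a halting state; the remaining \<open>j\<close> steps do not leave
    it.\<close>
  have "Suc k \<le> T" using k(1) T by simp
  then obtain j where j: "T = j + Suc k" by (metis add.commute le_Suc_ex)
  have "(step (com_machine K S R c e) ^^ T) (initial (com_machine K S R c e) w) = (step (com_machine K S R c e) ^^ j) (step (com_machine K S R c e) (e Skip, ts'))"
    unfolding j funpow_add o_apply 1 ..
  moreover obtain ts'' where "step (com_machine K S R c e) (e Skip, ts') = (if hd0 (s' R) = 0 then accept (com_machine K S R c e) else reject (com_machine K S R c e), ts'')"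
    using machine_halts[OF k(3)] by (cases "step (com_machine K S R c e) (e Skip, ts')") simp
  ultimately show ?thesis
    unfolding state_after_def by (simp add: step_halted)
qed

end

text \<open>The cap \<open>poly p (length w)\<close> depends on the input while the program, hence
  the machine, does not. Composing the polynomials gives the running time, and the added
  \<open>1\<close> is the verdict step.\<close>

theorem polytimeI:
  fixes p :: "nat poly"
  assumes wf: "wf_com K S c" and K: "0 < K" and S: "s < S" and L: "L \<subseteq> lists {1..s}"
    and run: "\<And>w. w \<in> lists {1..s} \<Longrightarrow>
      \<exists>s'. run (poly p (length w)) c (\<lambda>r. if r = 0 then w else []) = Some s' \<and>
           (hd0 (s' R) = 0 \<longleftrightarrow> w \<in> L)"
  shows "L \<in> polytime s"
proof -
  obtain e where e: "bij_betw e (residuals c) {0..<card (residuals c)}"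
    using ex_bij_betw_finite_nat[OF finite_residuals[of c]] by (elim exE)
  have S0: "0 < S" using S by simp
  define M where "M = com_machine K S R c e"
  define q where "q = pcompose (time_bound c) p + 1"
  have "decides_in_time s M (poly q) L"
    unfolding decides_in_time_def
  proof
    fix w assume "w \<in> lists {1..s}"
    from run[OF this] obtain s' where s': "run (poly p (length w)) c (\<lambda>r. if r = 0 then w else []) = Some s'"
      "hd0 (s' R) = 0 \<longleftrightarrow> w \<in> L"
      by (elim exE conjE)
    show "state_after M w (poly q (length w)) = (if w \<in> L then accept M else reject M)"
      unfolding M_def using s'(2) by (subst machine_state_after[OF e wf S0 K s'(1)]) (simp_all add: q_def poly_pcompose)
  qed
  then have "\<exists>M (q :: nat poly). wf_machine s M \<and> decides_in_time s M (poly q) L"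
    using wf_com_machine[OF e wf S0 K S] unfolding M_def by (intro exI conjI)
  then show ?thesis
    unfolding polytime_def using L by simp
qed

declare fun_upd_apply [simp del] fun_upd_same [simp] fun_upd_other [simp]

section \<open>Subroutines\<close>

text \<open>Without blanks in it, a stack has a blank top exactly when it is empty; the length bound
  keeps a loop that consumes the stack within the cap \<open>N\<close>.\<close>

definition word :: "nat \<Rightarrow> nat list \<Rightarrow> bool" where
  "word N xs \<longleftrightarrow> 0 \<notin> set xs \<and> length xs \<le> N"

lemma word_Nil [simp]: "word N []"
  by (simp add: word_def)

lemma word_Cons: "word N (x # xs) \<Longrightarrow> word N xs"
  by (auto simp: word_def)

lemma hd0_eq_0: "0 \<notin> set xs \<Longrightarrow> hd0 xs = 0 \<longleftrightarrow> xs = []"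
  by (cases xs) auto

lemma hd0_eq_0_word: "word N xs \<Longrightarrow> hd0 xs = 0 \<longleftrightarrow> xs = []"
  by (auto simp: word_def hd0_eq_0)

definition put :: "nat \<Rightarrow> nat \<Rightarrow> com" where
  "put b x = Shift b ;; Put b (\<lambda>_. x)"

definition put_top :: "nat \<Rightarrow> nat \<Rightarrow> com" where
  "put_top b a = Shift b ;; Put b (\<lambda>t. t a)"

lemma run_put [simp]: "run N (put b x) s = Some (s(b := x # s b))"
  by (simp add: put_def)

lemma run_put_top [simp]: "a \<noteq> b \<Longrightarrow> run N (put_top b a) s = Some (s(b := hd0 (s a) # s b))"
  by (simp add: put_top_def tops_apply)

definition move :: "(nat \<Rightarrow> bool) \<Rightarrow> nat \<Rightarrow> nat \<Rightarrow> com" where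
  "move P a b = Loop (\<lambda>t. P (t a)) (put_top b a ;; Pop a)"

lemma run_move:
  assumes "\<not> P 0" "a \<noteq> b" "length (takeWhile P (s a)) \<le> N"
  shows "run N (move P a b) s = Some (s(a := dropWhile P (s a), b := rev (takeWhile P (s a)) @ s b))"
proof -
  \<comment> \<open>Only the counter \<open>k\<close> of this loop decreases, while the body always
    runs under the full cap \<open>N\<close>. Keeping the two apart makes the induction possible,
    here and in the later loops.\<close>
  have "iter k (\<lambda>s. P (hd0 (s a))) (run N (put_top b a ;; Pop a)) s =
      Some (s(a := dropWhile P (s a), b := rev (takeWhile P (s a)) @ s b))"
    if "length (takeWhile P (s a)) \<le> k" for k
    using that
  proof (induction k arbitrary: s)
    case 0
    then show ?case using assms(1,2) by (cases "s a") (auto simp: fun_upd_idem split: if_splits)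
  next
    case (Suc k)
    show ?case
    proof (cases "s a")
      case Nil
      then show ?thesis using assms by (simp add: fun_upd_idem)
    next
      case (Cons x xs)
      show ?thesis
      proof (cases "P x")
        case True
        have "iter k (\<lambda>s. P (hd0 (s a))) (run N (put_top b a ;; Pop a)) (s(b := x # s b, a := xs)) =
            Some ((s(b := x # s b, a := xs))(a := dropWhile P xs, b := rev (takeWhile P xs) @ x # s b))"
          using Suc.IH[of "s(b := x # s b, a := xs)"] Suc.prems Cons True assms by simp
        then show ?thesis using Cons True assms by (simp add: fun_upd_twist[OF assms(2)])
      next
        case False
        then show ?thesis using Cons by (simp add: fun_upd_idem)
      qed
    qed
  qed
  from this[OF assms(3)] show ?thesis by (simp add: move_def tops_apply)
qed

lemma run_move_all:
  assumes "a \<noteq> b" "word N (s a)"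
  shows "run N (move (\<lambda>x. x \<noteq> 0) a b) s = Some (s(a := [], b := rev (s a) @ s b))"
proof -
  have "takeWhile (\<lambda>x. x \<noteq> 0) (s a) = s a" "dropWhile (\<lambda>x. x \<noteq> 0) (s a) = []"
    using assms(2) by (auto simp: word_def takeWhile_eq_all_conv intro: gr0I)
  then show ?thesis using run_move[of "\<lambda>x. x \<noteq> 0" a b s N] assms by (simp only: word_def simp_thms)
qed

text \<open>Moving to \<open>c\<close> reverses the word. The way back reverses it again while
  writing to both \<open>a\<close> and \<open>b\<close>, so \<open>a\<close> is restored and the
  order preserved.\<close>

definition copy :: "nat \<Rightarrow> nat \<Rightarrow> nat \<Rightarrow> com" where
  "copy a b c = move (\<lambda>x. x \<noteq> 0) a c ;; Loop (\<lambda>t. t c \<noteq> 0) (put_top a c ;; put_top b c ;; Pop c)"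

lemma run_copy:
  assumes "distinct [a, b, c]" "word N (s a)" "s c = []"
  shows "run N (copy a b c) s = Some (s(b := s a @ s b))"
proof -
  have loop: "iter k (\<lambda>s. hd0 (s c) \<noteq> 0) (run N (put_top a c ;; put_top b c ;; Pop c)) s =
      Some (s(a := rev (s c) @ s a, b := rev (s c) @ s b, c := []))"
    if "word k (s c)" for k s
    using that
  proof (induction k arbitrary: s)
    case 0
    then show ?case using assms(1) by (simp add: word_def fun_upd_idem)
  next
    case (Suc k)
    show ?case
    proof (cases "s c")
      case Nil
      then show ?thesis by (simp add: fun_upd_idem)
    next
      case (Cons x xs)
      have "x \<noteq> 0" using Suc.prems Cons by (auto simp: word_def)
      then show ?thesis
        using Suc.IH[of "s(a := x # s a, b := x # s b, c := xs)"] Suc.prems Cons assms(1)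
        by (auto simp: word_def fun_upd_twist)
    qed
  qed
  have "run N (move (\<lambda>x. x \<noteq> 0) a c) s = Some (s(a := [], c := rev (s a)))"
    using assms by (subst run_move_all) simp_all
  moreover have "word N (rev (s a))" using assms(2) by (simp add: word_def)
  ultimately show ?thesis
    using loop[of N "s(a := [], c := rev (s a))"] assms(1,3)
    by (simp add: copy_def tops_apply) (auto simp: fun_eq_iff fun_upd_apply)
qed

definition token :: "nat \<Rightarrow> nat \<Rightarrow> nat \<Rightarrow> nat \<Rightarrow> com" where
  "token d a b c = move (\<lambda>x. x \<noteq> 0 \<and> x \<noteq> d) a c ;; Pop a ;; move (\<lambda>x. x \<noteq> 0) c b"

definition upto :: "nat \<Rightarrow> nat list \<Rightarrow> nat list" where
  "upto d xs = takeWhile (\<lambda>x. x \<noteq> 0 \<and> x \<noteq> d) xs"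

definition after :: "nat \<Rightarrow> nat list \<Rightarrow> nat list" where
  "after d xs = tl (dropWhile (\<lambda>x. x \<noteq> 0 \<and> x \<noteq> d) xs)"

lemma upto_append: "0 \<notin> set xs \<Longrightarrow> d \<notin> set xs \<Longrightarrow> upto d (xs @ d # ys) = xs"
  unfolding upto_def by (induction xs) auto

lemma after_append: "0 \<notin> set xs \<Longrightarrow> d \<notin> set xs \<Longrightarrow> after d (xs @ d # ys) = ys"
  unfolding after_def by (induction xs) auto

lemma run_token:
  assumes "distinct [a, b, c]" "s c = []" "length (upto d (s a)) \<le> N"
  shows "run N (token d a b c) s = Some (s(a := after d (s a), b := upto d (s a) @ s b))"
proof -
  let ?s1 = "s(a := dropWhile (\<lambda>x. x \<noteq> 0 \<and> x \<noteq> d) (s a), c := rev (upto d (s a)))"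
  have 1: "run N (move (\<lambda>x. x \<noteq> 0 \<and> x \<noteq> d) a c) s = Some ?s1"
    using run_move[of "\<lambda>x. x \<noteq> 0 \<and> x \<noteq> d" a c s N] assms unfolding upto_def by simp
  have "0 \<notin> set (upto d (s a))" unfolding upto_def by (auto dest: set_takeWhileD)
  then have w: "word N (rev (upto d (s a)))" using assms(3) by (simp add: word_def)
  have 2: "run N (move (\<lambda>x. x \<noteq> 0) c b) (?s1(a := after d (s a))) =
      Some (?s1(a := after d (s a), c := [], b := upto d (s a) @ s b))"
    using assms(1) w by (subst run_move_all) simp_all
  show ?thesis
    using 1 2 assms(1,2) unfolding token_def after_def
    by simp (auto simp: fun_eq_iff fun_upd_apply)
qed

definition clear :: "nat \<Rightarrow> com" where
  "clear a = Loop (\<lambda>t. t a \<noteq> 0) (Pop a)"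

lemma run_clear:
  assumes "word N (s a)"
  shows "run N (clear a) s = Some (s(a := []))"
proof -
  have "iter k (\<lambda>s. hd0 (s a) \<noteq> 0) (run N (Pop a)) s = Some (s(a := []))" if "word k (s a)" for k
    using that
  proof (induction k arbitrary: s)
    case 0
    then show ?case by (simp add: word_def fun_upd_idem)
  next
    case (Suc k)
    show ?case
    proof (cases "s a")
      case Nil
      then show ?thesis by (simp add: fun_upd_idem)
    next
      case (Cons x xs)
      then show ?thesis using Suc.IH[of "s(a := xs)"] Suc.prems by (auto simp: word_def)
    qed
  qed
  from this[OF assms] show ?thesis by (simp add: clear_def tops_apply)
qed

definition equal :: "nat \<Rightarrow> nat \<Rightarrow> nat \<Rightarrow> com" where
  "equal a b c = Loop (\<lambda>t. t a \<noteq> 0 \<and> t a = t b) (Pop a ;; Pop b) ;;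
     Test (\<lambda>t. t a = 0 \<and> t b = 0) (put c 1) (clear a ;; clear b)"

lemma run_equal:
  assumes d: "distinct [a, b, c]" and w: "word N (s a)" "word N (s b)"
  shows "run N (equal a b c) s = Some (s(a := [], b := [], c := (if s a = s b then 1 # s c else s c)))"
proof -
  \<comment> \<open>What remains after the common prefix need not be known: the invariant records
    only that both remainders are empty iff the words agree.\<close>
  have "\<exists>xs ys. iter k (\<lambda>s. hd0 (s a) \<noteq> 0 \<and> hd0 (s a) = hd0 (s b)) (run N (Pop a ;; Pop b)) s =
        Some (s(a := xs, b := ys)) \<and> (xs = [] \<and> ys = [] \<longleftrightarrow> s a = s b) \<and> word N xs \<and> word N ys"
    if "length (s a) \<le> k" for k
    using that w
  proof (induction k arbitrary: s)
    case 0
    then show ?case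
      by (rule_tac exI[of _ "s a"], rule_tac exI[of _ "s b"]) (auto simp: fun_upd_idem)
  next
    case (Suc k)
    show ?case
    proof (cases "hd0 (s a) \<noteq> 0 \<and> hd0 (s a) = hd0 (s b)")
      case True
      then obtain x xs ys where *: "s a = x # xs" "s b = x # ys"
        by (cases "s a"; cases "s b") auto
      obtain xs' ys' where
        "iter k (\<lambda>s. hd0 (s a) \<noteq> 0 \<and> hd0 (s a) = hd0 (s b)) (run N (Pop a ;; Pop b)) (s(a := xs, b := ys)) =
          Some (s(a := xs', b := ys'))" "xs' = [] \<and> ys' = [] \<longleftrightarrow> xs = ys" "word N xs'" "word N ys'"
        using Suc.IH[of "s(a := xs, b := ys)"] Suc.prems * d word_Cons[of N x]
        by (auto simp: fun_upd_twist)
      then show ?thesis using * True d by (rule_tac exI[of _ xs'], rule_tac exI[of _ ys']) simp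
    next
      case False
      have "s a = [] \<and> s b = [] \<longleftrightarrow> s a = s b"
        using False Suc.prems(2) by (cases "s a"; cases "s b") (auto simp: word_def)
      then show ?thesis
        using False Suc.prems by (rule_tac exI[of _ "s a"], rule_tac exI[of _ "s b"]) auto
    qed
  qed
  from this[of N] w obtain xs ys where
    1: "run N (Loop (\<lambda>t. t a \<noteq> 0 \<and> t a = t b) (Pop a ;; Pop b)) s = Some (s(a := xs, b := ys))"
    and 2: "xs = [] \<and> ys = [] \<longleftrightarrow> s a = s b" and w': "word N xs" "word N ys"
    by (auto simp: word_def tops_apply)
  show ?thesis
  proof (cases "s a = s b")
    case True
    then show ?thesis using 1 2 d by (simp add: equal_def tops_apply)
  next
    case False
    then have "\<not> (hd0 xs = 0 \<and> hd0 ys = 0)" using 2 w' by (auto simp: hd0_eq_0_word)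
    then show ?thesis using 1 w' d False
      by (simp add: equal_def tops_apply run_clear) (auto simp: fun_eq_iff fun_upd_apply)
  qed
qed

declare neq0_conv [simp del]

section \<open>Encodings and binary arithmetic\<close>

definition bits :: "bool list \<Rightarrow> nat list" where
  "bits = map (\<lambda>b. if b then 2 else 1)"

definition toks :: "bool list list \<Rightarrow> nat list" where
  "toks xs = concat (map enc_bits xs)"

definition digits :: "nat \<Rightarrow> nat list" where
  "digits n = bits (binary n)"

lemma set_bits: "set (bits x) \<subseteq> {1, 2}"
  by (auto simp: bits_def)

lemma enc_bits_eq: "enc_bits x = bits x @ [3]"
  by (simp add: enc_bits_def bits_def)

lemma bits_inject [simp]: "bits x = bits y \<longleftrightarrow> x = y"
  using enc_bits_prefix[of x "[]" y "[]"] by (simp add: enc_bits_eq)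

lemma toks_Nil [simp]: "toks [] = []"
  by (simp add: toks_def)

lemma toks_Cons: "toks (x # xs) = bits x @ 3 # toks xs"
  by (simp add: toks_def enc_bits_eq)

lemma set_toks: "set (toks xs) \<subseteq> {1, 2, 3}"
proof (induction xs)
  case (Cons x xs)
  then show ?case using set_bits[of x] by (auto simp: toks_Cons)
qed simp

lemma toks_neq_Nil [simp]: "toks (x # xs) \<noteq> []"
  by (simp add: toks_Cons)

lemma length_le_toks: "length xs \<le> length (toks xs)"
  by (induction xs) (simp_all add: toks_Cons)

lemma upto_bits [simp]: "upto 3 (bits x @ 3 # r) = bits x"
  using set_bits[of x] by (intro upto_append) auto

lemma after_bits [simp]: "after 3 (bits x @ 3 # r) = r"
  using set_bits[of x] by (intro after_append) auto

lemma upto_toks [simp]: "upto 5 (toks x @ 5 # r) = toks x"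
  using set_toks[of x] by (intro upto_append) auto

lemma after_toks [simp]: "after 5 (toks x @ 5 # r) = r"
  using set_toks[of x] by (intro after_append) auto

lemma word_toks_Cons: "word N (toks (x # xs)) \<Longrightarrow> word N (bits x) \<and> word N (toks xs)"
  using set_bits[of x] set_toks[of xs] by (auto simp: word_def toks_Cons)

lemma word_lengthD: "word N xs \<Longrightarrow> length xs \<le> N"
  by (simp add: word_def)

lemma hd0_toks_Cons: "hd0 (toks (x # xs)) \<noteq> 0"
  using set_toks[of "x # xs"] by (cases "toks (x # xs)") auto

lemma hd0_digits: "hd0 (digits n) = (if n = 0 then 0 else if odd n then 2 else 1)"
  by (simp add: digits_def bits_def binary.simps[of n])

lemma tl_digits: "tl (digits n) = digits (n div 2)"
  by (simp add: digits_def bits_def binary.simps[of n] binary.simps[of 0])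

lemma digits_0 [simp]: "digits 0 = []"
  by (simp add: digits_def bits_def binary.simps[of 0])

lemma digits_pos: "n \<noteq> 0 \<Longrightarrow> digits n = (if odd n then 2 else 1) # digits (n div 2)"
  by (simp add: digits_def bits_def binary.simps[of n])

text \<open>Lets the cap on loops over digits be checked by comparing values with
  \<open>2 ^ N\<close>.\<close>

lemma length_digits: "length (digits n) \<le> k \<longleftrightarrow> n < 2 ^ k"
proof (induction k arbitrary: n)
  case 0
  show ?case by (cases "n = 0") (simp, subst digits_pos, simp_all)
next
  case (Suc k)
  show ?case
  proof (cases "n = 0")
    case False
    then have "length (digits n) = Suc (length (digits (n div 2)))" by (subst digits_pos) simp_all
    then show ?thesis using Suc[of "n div 2"] by (simp add: div_less_iff_less_mult mult.commute)
  qed simp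
qed

lemma word_digits: "word N (digits n) \<longleftrightarrow> n < 2 ^ N"
  using set_bits[of "binary n"] length_digits[of n N] by (auto simp: word_def digits_def)

lemma word_replicate [simp]: "word N (replicate k 1) \<longleftrightarrow> k \<le> N"
  by (auto simp: word_def)

text \<open>
  From here on the tapes have fixed roles. Tape 0 holds the input (after parsing: votes and
  coalition), 2 the state of the syntax automaton, 3 the candidates, 4 the favourite, 7 the number
  \<open>m - 1\<close> in unary, 8 is scratch space, 9 the names still to be processed, 10 the name \<open>x\<close> under
  consideration, 11 the ranking of the current vote, 12 a list being scanned for \<open>x\<close>, 13 and 14 two
  names being compared, 15 the number of hits, 16 the votes still to be processed, 17 the current
  weight, 18 an accumulated score, 19 the points of the current place and 20 those of \<open>x\<close> in unary,
  21 and 22 a summand and the carry, 23 the score to beat, 24 and 25 a copy of it and the result of the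
  comparison. Tape 26 is empty iff no check has failed.
\<close>

definition bit_of :: "nat \<Rightarrow> nat" where
  "bit_of a = (if a = 2 then 1 else 0)"

lemma bit_of_digits: "bit_of (hd0 (digits n)) = n mod 2"
  by (simp add: bit_of_def hd0_digits mod2_eq_if)

text \<open>Ripple-carry addition from the least significant bit, the carry 0 or 1 being written as
  symbol 1 or 2. It goes on until both summands and the carry are used up, so the sum of numbers
  without leading zeros has none. The digits pile up in reverse on tape 8, which the
  \<open>move\<close> at the end of \<open>add_weight\<close> undoes.\<close>

definition add_loop :: com where
  "add_loop = Loop (\<lambda>t. t 21 \<noteq> 0 \<or> t 18 \<noteq> 0 \<or> t 22 = 2)
     (Shift 8 ;; Put 8 (\<lambda>t. if odd (bit_of (t 21) + bit_of (t 18) + bit_of (t 22)) then 2 else 1) ;;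
      Put 22 (\<lambda>t. if 2 \<le> bit_of (t 21) + bit_of (t 18) + bit_of (t 22) then 2 else 1) ;;
      Pop 21 ;; Pop 18)"

lemma run_add_loop:
  assumes "s 21 = digits x" "s 18 = digits y" "s 22 = [1]" "x + y < 2 ^ N"
  shows "run N add_loop s =
    Some (s(21 := [], 18 := [], 22 := [1], 8 := rev (digits (x + y)) @ s 8))"
proof -
  define P where "P = (\<lambda>s :: state. hd0 (s 21) \<noteq> 0 \<or> hd0 (s 18) \<noteq> 0 \<or> hd0 (s 22) = 2)"
  define c where "c = (Shift 8 ;; Put 8 (\<lambda>t. if odd (bit_of (t 21) + bit_of (t 18) + bit_of (t 22)) then 2 else 1) ;;
      Put 22 (\<lambda>t. if 2 \<le> bit_of (t 21) + bit_of (t 18) + bit_of (t 22) then 2 else 1) ;;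
      Pop 21 ;; Pop 18)"
  \<comment> \<open>Generalised to an incoming carry \<open>z\<close>; the induction is on a bound
    for the number of digits of the total, which drops by one per round.\<close>
  have "iter k P (run N c) s =
      Some (s(21 := [], 18 := [], 22 := [1], 8 := rev (digits (x + y + z)) @ s 8))"
    if "s 21 = digits x" "s 18 = digits y" "s 22 = [if z = 1 then 2 else 1]" "z \<le> 1"
      "length (digits (x + y + z)) \<le> k" for k x y z s
    using that
  proof (induction k arbitrary: s x y z)
    case 0
    then have "x + y + z = 0" using length_digits[of "x + y + z" 0] by simp
    then show ?case using 0 by (simp add: P_def fun_upd_idem)
  next
    case (Suc k)
    show ?case
    proof (cases "x + y + z = 0")
      case True
      then show ?thesis using Suc.prems by (simp add: P_def fun_upd_idem)
    next
      case False
      then have P: "P s" using Suc.prems by (auto simp: P_def hd0_digits)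
      define t where "t = x mod 2 + y mod 2 + z"
      define z' where "z' = t div 2"
      have total: "x + y + z = t + (x div 2 + y div 2) * 2" unfolding t_def by simp
      have "t \<le> 3" using Suc.prems(4) mod_less_divisor[of 2 x] mod_less_divisor[of 2 y]
        unfolding t_def by linarith
      then have "t = 0 \<or> t = 1 \<or> t = 2 \<or> t = 3" by linarith
      then have z': "z' \<le> 1" "2 \<le> t \<longleftrightarrow> z' = 1" unfolding z'_def by auto
      have sum: "(x + y + z) div 2 = x div 2 + y div 2 + z'" "odd (x + y + z) = odd t"
        unfolding total z'_def by simp_all
      have dg: "digits (x + y + z) = (if odd t then 2 else 1) # digits (x div 2 + y div 2 + z')"
        using digits_pos[of "x + y + z", unfolded sum] False by simp
      have b: "bit_of (hd0 (s 21)) + bit_of (hd0 (s 18)) + bit_of (hd0 (s 22)) = t"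
        using Suc.prems(1-4) by (auto simp: bit_of_digits t_def) (auto simp: bit_of_def)
      have r: "run N c s = Some (s(8 := (if odd t then 2 else 1) # s 8, 22 := [if z' = 1 then 2 else 1],
          21 := digits (x div 2), 18 := digits (y div 2)))"
        using b z'(2) Suc.prems(1-3) unfolding c_def by (simp add: tops_apply tl_digits del: even_add odd_add)
      show ?thesis
        using P r Suc.prems(5) z'(1) dg
        by (simp add: Suc.IH[where z = z'] fun_upd_twist)
    qed
  qed
  from this[where z = 0] assms show ?thesis
    by (simp add: add_loop_def P_def c_def tops_apply length_digits)
qed

definition add_weight :: com where
  "add_weight = put 22 1 ;; copy 17 21 8 ;; add_loop ;; Pop 22 ;; move (\<lambda>x. x \<noteq> 0) 8 18"

lemma run_add_weight:
  assumes "s 17 = digits x" "s 18 = digits y" "s 8 = []" "s 21 = []" "s 22 = []" "x + y < 2 ^ N"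
  shows "run N add_weight s = Some (s(18 := digits (x + y)))"
proof -
  have "word N (digits x)" "word N (rev (digits (x + y)))"
    using assms(6) word_digits by (auto simp: word_def)
  then show ?thesis
    using assms unfolding add_weight_def
    by (simp add: run_copy run_add_loop[where x = x and y = y] run_move_all fun_upd_twist fun_upd_idem)
qed

definition add_multiple :: com where
  "add_multiple = Loop (\<lambda>t. t 20 \<noteq> 0) (Pop 20 ;; add_weight)"

lemma run_add_multiple:
  assumes "s 17 = digits x" "s 18 = digits y" "s 8 = []" "s 21 = []" "s 22 = []"
    "s 20 = replicate k 1" "k \<le> N" "k * x + y < 2 ^ N"
  shows "run N add_multiple s = Some (s(18 := digits (k * x + y), 20 := []))"
proof -
  define c where "c = (Pop 20 ;; add_weight)"
  have "iter l (\<lambda>s. hd0 (s 20) \<noteq> 0) (run N c) s =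
     Some (s(18 := digits (k * x + y), 20 := []))" if "k \<le> l" for l
    using that assms(1-6) assms(8)
  proof (induction l arbitrary: s y k)
    case 0
    then show ?case by (simp add: fun_upd_idem)
  next
    case (Suc l)
    show ?case
    proof (cases k)
      case 0
      then show ?thesis using Suc.prems by (simp add: fun_upd_idem)
    next
      case (Suc k')
      have "run N c s = Some (s(20 := replicate k' 1, 18 := digits (x + y)))"
        using Suc.prems Suc by (simp add: c_def run_add_weight[where x = x and y = y])
      then show ?thesis
        using Suc.prems Suc
        by (simp add: Suc.IH[where k = k' and y = "x + y"] fun_upd_twist add_ac)
    qed
  qed
  from this[OF assms(7)] show ?thesis by (simp add: add_multiple_def c_def tops_apply)
qed

text \<open>\<open>Put\<close> overwrites the top instead of pushing, so repeated failures leave a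
  single symbol on tape 26.\<close>

definition mark_bad :: com where
  "mark_bad = Put 26 (\<lambda>_. 1)"

definition flag :: "bool \<Rightarrow> nat list" where
  "flag b = (if b then [] else [1])"

lemma run_mark_bad [simp]: "s 26 = flag b \<Longrightarrow> run N mark_bad s = Some (s(26 := flag False))"
  by (simp add: mark_bad_def flag_def)

lemma less_by_halves: "x div 2 < y div 2 \<or> (x div 2 = y div 2 \<and> x mod 2 < y mod 2) \<longleftrightarrow> x < y"
  for x y :: nat
proof -
  have *: "a < b \<or> (a = b \<and> c < d) \<longleftrightarrow> 2 * a + c < 2 * b + d" if "c < 2" "d < 2" for a b c d :: nat
    using that by linarith
  show ?thesis using *[of "x mod 2" "y mod 2" "x div 2" "y div 2"] by simp
qed

text \<open>Justifies comparing from the least significant bit: \<open>g\<close> is the verdict of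
  the lower bits, the current bit overrules it when the two numbers differ there, and the higher
  bits overrule both.\<close>

lemma compare_by_halves:
  fixes x y :: nat
  shows "(if x div 2 < y div 2 then p else if y div 2 < x div 2 then q
      else if x mod 2 = y mod 2 then g else if x mod 2 < y mod 2 then p else q) =
    (if x < y then p else if y < x then q else g)"
proof -
  have *: "(if a < b then p else if b < a then q else if c = d then g else if c < d then p else q) =
    (if a < b \<or> (a = b \<and> c < d) then p else if b < a \<or> (b = a \<and> d < c) then q else g)"
    for a b c d :: nat by auto
  show ?thesis by (subst *) (simp only: less_by_halves)
qed

lemma length_digits_half: "length (digits n) \<le> Suc k \<Longrightarrow> length (digits (n div 2)) \<le> k"
  by (cases "n = 0") (simp, subst (asm) digits_pos, simp_all)

text \<open>Symbol 2 on tape 25 records that the number on 18 is the larger one; the initial 1 lets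
  equality pass.\<close>

definition check_le :: com where
  "check_le = put 25 1 ;;
     Loop (\<lambda>t. t 18 \<noteq> 0 \<or> t 24 \<noteq> 0)
       (Put 25 (\<lambda>t. if bit_of (t 18) = bit_of (t 24) then t 25
                   else if bit_of (t 18) < bit_of (t 24) then 1 else 2) ;; Pop 18 ;; Pop 24) ;;
     Test (\<lambda>t. t 25 = 2) mark_bad Skip ;; Pop 25"

lemma run_check_le:
  assumes "s 18 = digits x" "s 24 = digits y" "s 25 = []" "s 26 = flag b" "x < 2 ^ N" "y < 2 ^ N"
  shows "run N check_le s = Some (s(18 := [], 24 := [], 26 := flag (b \<and> x \<le> y)))"
proof -
  define P where "P = (\<lambda>s :: state. hd0 (s 18) \<noteq> 0 \<or> hd0 (s 24) \<noteq> 0)"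
  define c where "c = (Put 25 (\<lambda>t. if bit_of (t 18) = bit_of (t 24) then t 25
                   else if bit_of (t 18) < bit_of (t 24) then 1 else 2) ;; Pop 18 ;; Pop 24)"
  have "iter k P (run N c) s =
      Some (s(18 := [], 24 := [], 25 := [if x < y then 1 else if y < x then 2 else g]))"
    if "s 18 = digits x" "s 24 = digits y" "s 25 = [g]" "length (digits x) \<le> k" "length (digits y) \<le> k"
    for k x y g s
    using that
  proof (induction k arbitrary: s x y g)
    case 0
    then have "x = 0" "y = 0" using length_digits[of x 0] length_digits[of y 0] by simp_all
    then show ?case using 0 by (simp add: P_def fun_upd_idem)
  next
    case (Suc k)
    show ?case
    proof (cases "x = 0 \<and> y = 0")
      case True
      then show ?thesis using Suc.prems by (simp add: P_def fun_upd_idem)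
    next
      case False
      then have P: "P s" using Suc.prems by (auto simp: P_def hd0_digits)
      define g' where "g' = (if x mod 2 = y mod 2 then g else if x mod 2 < y mod 2 then 1 else 2)"
      have r: "run N c s = Some (s(25 := [g'], 18 := digits (x div 2), 24 := digits (y div 2)))"
        using Suc.prems unfolding c_def g'_def by (simp add: tops_apply bit_of_digits tl_digits)
      have "length (digits (x div 2)) \<le> k" "length (digits (y div 2)) \<le> k"
        using Suc.prems(4,5) by (simp_all only: length_digits_half)
      note IH = Suc.IH[where x = "x div 2" and y = "y div 2" and g = g', OF _ _ _ this]
      have "(if x div 2 < y div 2 then 1 else if y div 2 < x div 2 then 2 else g') =
          (if x < y then 1 else if y < x then 2 else g)"
        unfolding g'_def by (rule compare_by_halves)
      then show ?thesis using P r by (simp add: IH fun_upd_twist)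
    qed
  qed
  note iter = this
  have "run N (Loop (\<lambda>t. t 18 \<noteq> 0 \<or> t 24 \<noteq> 0) c) (s(25 := [1])) =
      Some (s(18 := [], 24 := [], 25 := [if y < x then 2 else 1]))"
    using iter[of "s(25 := [1])" x y 1 N] assms
    by (simp add: P_def tops_apply length_digits fun_upd_twist)
  then show ?thesis
    using assms unfolding check_le_def c_def[symmetric]
    by (cases "y < x") (simp_all add: tops_apply fun_upd_twist fun_upd_idem)
qed

lemma replicate_1 [simp]: "replicate 1 x = [x]"
  by (simp add: One_nat_def)

section \<open>Validity and scores\<close>

definition count_hits :: "nat \<Rightarrow> com" where
  "count_hits l = copy l 12 8 ;;
     Loop (\<lambda>t. t 12 \<noteq> 0) (token 3 12 13 8 ;; copy 10 14 8 ;; equal 14 13 15)"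

lemma run_count_hits:
  assumes l: "l = 3 \<or> l = 11" and s: "s l = toks ys" "s 10 = bits x"
    "s 8 = []" "s 12 = []" "s 13 = []" "s 14 = []" "s 15 = []"
    and w: "word N (toks ys)" "word N (bits x)"
  shows "run N (count_hits l) s = Some (s(15 := replicate (count_list ys x) 1))"
proof -
  define c where "c = (token 3 12 13 8 ;; copy 10 14 8 ;; equal 14 13 15)"
  have loop: "iter k (\<lambda>s. hd0 (s 12) \<noteq> 0) (run N c) s =
      Some (s(12 := [], 15 := replicate (count_list ys x + h) 1))"
    if "s 12 = toks ys" "s 10 = bits x" "s 8 = []" "s 13 = []" "s 14 = []" "s 15 = replicate h 1"
      "word N (toks ys)" "length ys \<le> k" for k s h
    using that
  proof (induction ys arbitrary: s h k)
    case Nil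
    then show ?case by (cases k) (simp_all add: fun_upd_idem)
  next
    case (Cons y ys)
    then obtain k' where k: "k = Suc k'" "length ys \<le> k'" by (cases k) auto
    note wy = word_toks_Cons[OF Cons.prems(7)]
    have "run N c s = Some (s(12 := toks ys, 15 := replicate (if y = x then Suc h else h) 1))"
      using Cons.prems wy w(2) word_lengthD[of N "bits y"] unfolding c_def
      by (simp add: run_token run_copy run_equal toks_Cons fun_upd_twist fun_upd_idem)
    moreover have "hd0 (s 12) \<noteq> 0" using Cons.prems(1) hd0_toks_Cons by simp
    ultimately show ?case
      using Cons.prems k wy Cons.IH[of "s(12 := toks ys, 15 := replicate (if y = x then Suc h else h) 1)"
        "if y = x then Suc h else h" k']
      by (simp add: fun_upd_twist One_nat_def)
  qed
  have "length ys \<le> N" using length_le_toks[of ys] w(1) by (simp add: word_def)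
  then show ?thesis
    using l s w loop[of "s(12 := toks ys)" 0 N] unfolding count_hits_def c_def[symmetric]
    by (auto simp: run_copy tops_apply fun_upd_twist fun_upd_idem)
qed

definition check_member :: "nat \<Rightarrow> com" where
  "check_member l = count_hits l ;; Test (\<lambda>t. t 15 \<noteq> 0) (Pop 15) mark_bad ;;
     Test (\<lambda>t. t 15 \<noteq> 0) mark_bad Skip ;; clear 15"

lemma run_check_member:
  assumes l: "l = 3 \<or> l = 11" and s: "s l = toks ys" "s 10 = bits x"
    "s 8 = []" "s 12 = []" "s 13 = []" "s 14 = []" "s 15 = []" "s 26 = flag b"
    and w: "word N (toks ys)" "word N (bits x)"
  shows "run N (check_member l) s = Some (s(26 := flag (b \<and> count_list ys x = 1)))"
proof -
  note count = run_count_hits[OF l s(1-7) w]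
  have le: "count_list ys x \<le> N"
    using count_le_length[of ys x] length_le_toks[of ys] w(1) by (simp add: word_def)
  consider "count_list ys x = 0" | "count_list ys x = 1" | n where "count_list ys x = Suc (Suc n)"
    by (metis One_nat_def not0_implies_Suc)
  then show ?thesis
  proof cases
    case 1
    then show ?thesis using s
      by (simp add: check_member_def count tops_apply run_clear fun_upd_twist fun_upd_idem)
  next
    case 2
    then show ?thesis using s
      by (simp add: check_member_def count tops_apply run_clear fun_upd_twist fun_upd_idem)
  next
    case 3
    then have "word N (1 # replicate n 1)" using le by (simp add: word_def)
    then show ?thesis using s 3
      by (simp add: check_member_def count tops_apply run_clear fun_upd_twist fun_upd_idem)
  qed
qed

text \<open>Demanding exactly one occurrence serves two purposes: against the candidates it tests
  membership, and for a list checked against itself it tests distinctness.\<close>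

definition check_members :: "nat \<Rightarrow> com" where
  "check_members l = Loop (\<lambda>t. t 9 \<noteq> 0) (token 3 9 10 8 ;; check_member l ;; clear 10)"

lemma run_check_members:
  assumes l: "l = 3 \<or> l = 11" and s: "s 9 = toks xs" "s l = toks ys" "s 8 = []" "s 10 = []"
    "s 12 = []" "s 13 = []" "s 14 = []" "s 15 = []" "s 26 = flag b"
    and w: "word N (toks xs)" "word N (toks ys)"
  shows "run N (check_members l) s =
    Some (s(9 := [], 26 := flag (b \<and> (\<forall>x \<in> set xs. count_list ys x = 1))))"
proof -
  define c where "c = (token 3 9 10 8 ;; check_member l ;; clear 10)"
  have "iter k (\<lambda>s. hd0 (s 9) \<noteq> 0) (run N c) s =
      Some (s(9 := [], 26 := flag (b \<and> (\<forall>x \<in> set xs. count_list ys x = 1))))"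
    if "length xs \<le> k" for k
    using that s w(1)
  proof (induction xs arbitrary: s b k)
    case Nil
    then show ?case by (cases k) (simp_all add: fun_upd_idem)
  next
    case (Cons x xs)
    then obtain k' where k: "k = Suc k'" "length xs \<le> k'" by (cases k) auto
    note wx = word_toks_Cons[OF Cons.prems(11)]
    have l': "l \<noteq> 9" "l \<noteq> 10" "l \<noteq> 26" using l by auto
    have "run N c s = Some (s(9 := toks xs, 26 := flag (b \<and> count_list ys x = 1)))"
      using Cons.prems wx w(2) l l' word_lengthD[of N "bits x"] unfolding c_def
      by (simp add: run_token run_check_member[where ys = ys and x = x and b = b] run_clear toks_Cons
          fun_upd_twist fun_upd_idem)
    moreover have "hd0 (s 9) \<noteq> 0" using Cons.prems(2) hd0_toks_Cons by simp
    ultimately show ?case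
      using Cons.prems k wx l' Cons.IH[of k' "s(9 := toks xs, 26 := flag (b \<and> count_list ys x = 1))"
        "b \<and> count_list ys x = 1"]
      by (simp add: fun_upd_twist conj_assoc)
  qed
  moreover have "length xs \<le> N" using length_le_toks[of xs] w(1) by (simp add: word_def)
  ultimately show ?thesis unfolding check_members_def c_def by (simp add: tops_apply)
qed

lemma set_digits: "set (digits n) \<subseteq> {1, 2}"
  using set_bits by (simp add: digits_def)

lemma enc_nat_eq: "enc_nat n = digits n @ [3]"
  by (simp add: enc_nat_def enc_bits_eq digits_def)

lemma upto_digits [simp]: "upto 3 (digits n @ 3 # r) = digits n"
  by (simp add: digits_def)

lemma after_digits [simp]: "after 3 (digits n @ 3 # r) = r"
  by (simp add: digits_def)

text \<open>The remainder \<open>r\<close> is carried along because votes and coalition stay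
  together on tape 0. The loops over votes stop at the bracket 5, which never begins a vote.\<close>

definition vote_word :: "(nat \<times> vote) list \<Rightarrow> nat list \<Rightarrow> nat list" where
  "vote_word vs r = concat (map enc_vote vs) @ 5 # r"

lemma vote_word_Nil [simp]: "vote_word [] r = 5 # r"
  by (simp add: vote_word_def)

lemma vote_word_Cons: "vote_word ((w, v) # vs) r = digits w @ 3 # 4 # toks v @ 5 # vote_word vs r"
  by (simp add: vote_word_def enc_vote_def enc_nat_eq enc_list_def toks_def)

lemma hd0_vote_word: "hd0 (vote_word (a # vs) r) \<noteq> 0 \<and> hd0 (vote_word (a # vs) r) \<noteq> 5"
proof (cases a)
  case (Pair w v)
  then show ?thesis using set_digits[of w] by (cases "digits w") (auto simp: vote_word_Cons)
qed

lemma word_vote_word_Cons: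
  assumes "word N (vote_word ((w, v) # vs) r)"
  shows "word N (digits w)" "word N (toks v)" "word N (vote_word vs r)"
  using assms by (auto simp: vote_word_Cons word_def)

lemma length_le_vote_word: "length vs \<le> length (vote_word vs r)"
proof (induction vs)
  case (Cons a vs)
  then show ?case by (cases a) (simp add: vote_word_Cons)
qed simp

definition valid_vote :: "bool list list \<Rightarrow> nat \<times> vote \<Rightarrow> bool" where
  "valid_vote cs a \<longleftrightarrow>
     (\<forall>x \<in> set (snd a). count_list cs x = 1) \<and> (\<forall>x \<in> set (snd a). count_list (snd a) x = 1)"

definition check_votes :: com where
  "check_votes = copy 0 16 8 ;; Loop (\<lambda>t. t 16 \<noteq> 0 \<and> t 16 \<noteq> 5)
     (token 3 16 17 8 ;; clear 17 ;; Pop 16 ;; token 5 16 11 8 ;; copy 11 9 8 ;; check_members 3 ;;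
      copy 11 9 8 ;; check_members 11 ;; clear 11) ;; clear 16"

lemma run_check_votes:
  assumes s: "s 0 = vote_word vs r" "s 3 = toks cs" "s 26 = flag b"
    and e: "s 8 = []" "s 9 = []" "s 10 = []" "s 11 = []" "s 12 = []" "s 13 = []" "s 14 = []"
      "s 15 = []" "s 16 = []" "s 17 = []"
    and w: "word N (vote_word vs r)" "word N (toks cs)"
  shows "run N check_votes s = Some (s(26 := flag (b \<and> (\<forall>a \<in> set vs. valid_vote cs a))))"
proof -
  define c where "c = (token 3 16 17 8 ;; clear 17 ;; Pop 16 ;; token 5 16 11 8 ;; copy 11 9 8 ;;
      check_members 3 ;; copy 11 9 8 ;; check_members 11 ;; clear 11)"
  have loop: "iter k (\<lambda>s. hd0 (s 16) \<noteq> 0 \<and> hd0 (s 16) \<noteq> 5) (run N c) s =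
      Some (s(16 := 5 # r, 26 := flag (b \<and> (\<forall>a \<in> set vs. valid_vote cs a))))"
    if "length vs \<le> k" "s 16 = vote_word vs r" "s 3 = toks cs" "s 26 = flag b"
      "s 8 = []" "s 9 = []" "s 10 = []" "s 11 = []" "s 12 = []" "s 13 = []" "s 14 = []"
      "s 15 = []" "s 17 = []" "word N (vote_word vs r)" for k s
    using that
  proof (induction vs arbitrary: s b k)
    case Nil
    then show ?case by (cases k) (simp_all add: fun_upd_idem)
  next
    case (Cons a vs)
    then obtain k' where k: "k = Suc k'" "length vs \<le> k'" by (cases k) auto
    obtain w v where a: "a = (w, v)" by fastforce
    note wx = word_vote_word_Cons[OF Cons.prems(14)[unfolded a]]
    have "run N c s = Some (s(16 := vote_word vs r, 26 := flag (b \<and> valid_vote cs a)))"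
      using Cons.prems wx w(2) word_lengthD[OF wx(1)] word_lengthD[OF wx(2)] unfolding c_def
      by (simp add: a vote_word_Cons run_token run_copy run_clear
          run_check_members[where xs = v and ys = cs and b = b]
          run_check_members[where xs = v and ys = v and b = "b \<and> (\<forall>x \<in> set v. count_list cs x = 1)"]
          valid_vote_def conj_assoc fun_upd_twist fun_upd_idem)
    moreover have "hd0 (s 16) \<noteq> 0 \<and> hd0 (s 16) \<noteq> 5" using Cons.prems(2) hd0_vote_word by simp
    ultimately show ?case
      using Cons.prems k wx Cons.IH[of k' "s(16 := vote_word vs r, 26 := flag (b \<and> valid_vote cs a))"
        "b \<and> valid_vote cs a"]
      by (simp add: fun_upd_twist conj_assoc)
  qed
  have "length vs \<le> N" using length_le_vote_word[of vs r] w(1) by (simp add: word_def)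
  moreover have "word N (5 # r)" using w(1) by (auto simp: word_def vote_word_def)
  ultimately show ?thesis
    using s e w loop[of N "s(16 := vote_word vs r)"] unfolding check_votes_def c_def[symmetric]
    by (simp add: tops_apply run_copy run_clear fun_upd_twist fun_upd_idem)
qed

text \<open>For repetition-free rankings these are the Borda points when \<open>k = m - 1\<close>.\<close>

fun place_points :: "nat \<Rightarrow> 'a list \<Rightarrow> 'a \<Rightarrow> nat" where
  "place_points k [] x = 0"
| "place_points k (y # ys) x = (if y = x then k else 0) + place_points (k - 1) ys x"

definition count_points :: com where
  "count_points = copy 7 19 8 ;; Loop (\<lambda>t. t 11 \<noteq> 0)
     (token 3 11 13 8 ;; copy 10 14 8 ;; equal 14 13 15 ;;
      Test (\<lambda>t. t 15 \<noteq> 0) (Pop 15 ;; copy 19 20 8) Skip ;; Pop 19) ;; clear 19"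

lemma run_count_points:
  assumes s: "s 11 = toks ys" "s 10 = bits x" "s 7 = replicate m 1"
    and e: "s 8 = []" "s 13 = []" "s 14 = []" "s 15 = []" "s 19 = []" "s 20 = []"
    and w: "word N (toks ys)" "word N (bits x)" "m \<le> N"
  shows "run N count_points s = Some (s(11 := [], 20 := replicate (place_points m ys x) 1))"
proof -
  define c where "c = (token 3 11 13 8 ;; copy 10 14 8 ;; equal 14 13 15 ;;
      Test (\<lambda>t. t 15 \<noteq> 0) (Pop 15 ;; copy 19 20 8) Skip ;; Pop 19)"
  have loop: "iter k (\<lambda>s. hd0 (s 11) \<noteq> 0) (run N c) s =
      Some (s(11 := [], 19 := replicate (m - length ys) 1,
        20 := replicate (place_points m ys x + h) 1))"
    if "length ys \<le> k" "s 11 = toks ys" "s 10 = bits x" "s 19 = replicate m 1" "s 20 = replicate h 1"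
      "s 8 = []" "s 13 = []" "s 14 = []" "s 15 = []" "word N (toks ys)" "m \<le> N" for k s h m
    using that
  proof (induction ys arbitrary: s h m k)
    case Nil
    then show ?case by (cases k) (simp_all add: fun_upd_idem)
  next
    case (Cons y ys)
    then obtain k' where k: "k = Suc k'" "length ys \<le> k'" by (cases k) auto
    note wy = word_toks_Cons[OF Cons.prems(10)]
    define h' where "h' = (if y = x then m else 0) + h"
    \<comment> \<open>The case \<open>m = 0\<close> matters: popping the empty stack matches
      truncated subtraction. It arises at the last place of a complete vote and beyond it in
      overlong ones.\<close>
    have tl: "tl (replicate m 1) = replicate (m - 1) (1::nat)" by (cases m) simp_all
    have "run N c s = Some (s(11 := toks ys, 19 := replicate (m - 1) 1, 20 := replicate h' 1))"
      using Cons.prems wy w(2) word_lengthD[of N "bits y"] tl unfolding c_def h'_def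
      by (simp add: run_token run_copy run_equal toks_Cons tops_apply fun_upd_twist fun_upd_idem
          replicate_add)
    moreover have "hd0 (s 11) \<noteq> 0" using Cons.prems(2) hd0_toks_Cons by simp
    moreover have "place_points (m - 1) ys x + h' = place_points m (y # ys) x + h"
      by (simp add: h'_def)
    moreover have "m - 1 - length ys = m - length (y # ys)" by (simp add: One_nat_def)
    ultimately show ?case
      using Cons.prems k wy Cons.IH[of k' "s(11 := toks ys, 19 := replicate (m - 1) 1, 20 := replicate h' 1)"
        "m - 1" h']
      by (simp add: fun_upd_twist del: place_points.simps)
  qed
  have "length ys \<le> N" using length_le_toks[of ys] w(1) by (simp add: word_def)
  then show ?thesis
    using s e w loop[of N "s(19 := replicate m 1)" m 0] unfolding count_points_def c_def[symmetric]
    by (simp add: tops_apply run_copy run_clear fun_upd_twist fun_upd_idem)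
qed

definition vote_score :: "nat \<Rightarrow> (nat \<times> 'a list) list \<Rightarrow> 'a \<Rightarrow> nat" where
  "vote_score m vs x = (\<Sum>(w, v) \<leftarrow> vs. place_points m v x * w)"

lemma vote_score_simps [simp]:
  "vote_score m [] x = 0"
  "vote_score m ((w, v) # vs) x = place_points m v x * w + vote_score m vs x"
  by (simp_all add: vote_score_def)

definition add_score :: com where
  "add_score = Loop (\<lambda>t. t 16 \<noteq> 0 \<and> t 16 \<noteq> 5)
     (token 3 16 17 8 ;; Pop 16 ;; token 5 16 11 8 ;; count_points ;; add_multiple ;; clear 17)"

lemma run_add_score:
  assumes s: "s 16 = vote_word vs r" "s 10 = bits x" "s 7 = replicate m 1" "s 18 = digits y"
    and e: "s 8 = []" "s 11 = []" "s 13 = []" "s 14 = []" "s 15 = []" "s 17 = []" "s 19 = []"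
      "s 20 = []" "s 21 = []" "s 22 = []"
    and w: "word N (vote_word vs r)" "word N (bits x)" "m \<le> N"
    and b: "\<forall>(w, v) \<in> set vs. place_points m v x \<le> N" "y + vote_score m vs x < 2 ^ N"
  shows "run N add_score s = Some (s(16 := 5 # r, 18 := digits (y + vote_score m vs x)))"
proof -
  define c where
    "c = (token 3 16 17 8 ;; Pop 16 ;; token 5 16 11 8 ;; count_points ;; add_multiple ;; clear 17)"
  have "iter k (\<lambda>s. hd0 (s 16) \<noteq> 0 \<and> hd0 (s 16) \<noteq> 5) (run N c) s =
      Some (s(16 := 5 # r, 18 := digits (y + vote_score m vs x)))"
    if "length vs \<le> k" for k
    using that s e w(1) b
  proof (induction vs arbitrary: s y k)
    case Nil
    then show ?case by (cases k) (simp_all add: fun_upd_idem)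
  next
    case (Cons a vs)
    then obtain k' where k: "k = Suc k'" "length vs \<le> k'" by (cases k) auto
    obtain u v where a: "a = (u, v)" by fastforce
    have "word N (vote_word ((u, v) # vs) r)" using Cons.prems a by simp
    note wx = word_vote_word_Cons[OF this]
    let ?y = "place_points m v x * u + y"
    have "run N c s = Some (s(16 := vote_word vs r, 18 := digits ?y))"
      using Cons.prems wx w(2,3) word_lengthD[OF wx(1)] word_lengthD[OF wx(2)] unfolding c_def
      by (simp add: a vote_word_Cons run_token run_clear
          run_count_points[where ys = v and x = x and m = m]
          run_add_multiple[where x = u and y = y and k = "place_points m v x"]
          fun_upd_twist fun_upd_idem)
    moreover have "hd0 (s 16) \<noteq> 0 \<and> hd0 (s 16) \<noteq> 5" using Cons.prems(2) hd0_vote_word by simp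
    moreover have eq: "?y + vote_score m vs x = y + vote_score m (a # vs) x" by (simp add: a)
    ultimately show ?case
      using Cons.prems k wx Cons.IH[of k' "s(16 := vote_word vs r, 18 := digits ?y)" ?y]
      unfolding eq by (simp add: fun_upd_twist)
  qed
  moreover have "length vs \<le> N" using length_le_vote_word[of vs r] w(1) by (simp add: word_def)
  ultimately show ?thesis unfolding add_score_def c_def by (simp add: tops_apply)
qed

text \<open>Adds what \<open>p\<close> receives when the whole coalition ranks it first. Tape 7 is
  copied afresh for each weight because \<open>add_multiple\<close> consumes its counter.\<close>

definition add_tops :: com where
  "add_tops = Loop (\<lambda>t. t 16 \<noteq> 0 \<and> t 16 \<noteq> 5) (token 3 16 17 8 ;; copy 7 20 8 ;; add_multiple ;; clear 17)"

definition weight_word :: "nat list \<Rightarrow> nat list" where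
  "weight_word ws = concat (map enc_nat ws) @ [5]"

lemma weight_word_Nil [simp]: "weight_word [] = [5]"
  by (simp add: weight_word_def)

lemma weight_word_Cons: "weight_word (w # ws) = digits w @ 3 # weight_word ws"
  by (simp add: weight_word_def enc_nat_eq)

lemma length_le_weight_word: "length ws \<le> length (weight_word ws)"
  by (induction ws) (simp_all add: weight_word_Cons)

lemma run_add_tops:
  assumes s: "s 16 = weight_word ws" "s 7 = replicate m 1" "s 18 = digits y"
    and e: "s 8 = []" "s 17 = []" "s 20 = []" "s 21 = []" "s 22 = []"
    and w: "word N (weight_word ws)" "m \<le> N" and b: "y + m * sum_list ws < 2 ^ N"
  shows "run N add_tops s = Some (s(16 := [5], 18 := digits (y + m * sum_list ws)))"
proof -
  define c where "c = (token 3 16 17 8 ;; copy 7 20 8 ;; add_multiple ;; clear 17)"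
  have "iter k (\<lambda>s. hd0 (s 16) \<noteq> 0 \<and> hd0 (s 16) \<noteq> 5) (run N c) s =
      Some (s(16 := [5], 18 := digits (y + m * sum_list ws)))"
    if "length ws \<le> k" for k
    using that s e w(1) b
  proof (induction ws arbitrary: s y k)
    case Nil
    then show ?case by (cases k) (simp_all add: fun_upd_idem)
  next
    case (Cons u ws)
    then obtain k' where k: "k = Suc k'" "length ws \<le> k'" by (cases k) auto
    have wu: "word N (digits u)" "word N (weight_word ws)"
      using Cons.prems by (auto simp: weight_word_Cons word_def)
    let ?y = "m * u + y"
    have "run N c s = Some (s(16 := weight_word ws, 18 := digits ?y))"
      using Cons.prems wu w(2) word_lengthD[OF wu(1)] unfolding c_def
      by (simp add: weight_word_Cons run_token run_clear run_copy
          run_add_multiple[where x = u and y = y and k = m] fun_upd_twist fun_upd_idem distrib_left)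
    moreover have "hd0 (s 16) \<noteq> 0 \<and> hd0 (s 16) \<noteq> 5"
      using Cons.prems(2) set_digits[of u] by (cases "digits u") (auto simp: weight_word_Cons)
    moreover have eq: "?y + m * sum_list ws = y + m * sum_list (u # ws)" by (simp add: distrib_left)
    ultimately show ?case
      using Cons.prems k wu Cons.IH[of k' "s(16 := weight_word ws, 18 := digits ?y)" ?y]
      unfolding eq by (simp add: fun_upd_twist del: sum_list.Cons)
  qed
  moreover have "length ws \<le> N" using length_le_weight_word[of ws] w(1) by (simp add: word_def)
  ultimately show ?thesis unfolding add_tops_def c_def by (simp add: tops_apply)
qed

section \<open>Deciding a well-formed instance\<close>

text \<open>Each name contains the symbol 3 exactly once, as its terminator; the last
  \<open>Pop\<close> turns the number of candidates into the points of a first place.\<close>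

definition count_candidates :: com where
  "count_candidates = copy 3 9 8 ;;
     Loop (\<lambda>t. t 9 \<noteq> 0) (Test (\<lambda>t. t 9 = 3) (put 7 1) Skip ;; Pop 9) ;; Pop 7"

lemma count_list_toks: "count_list (toks cs) 3 = length cs"
proof (induction cs)
  case (Cons c cs)
  have "count_list (bits c) 3 = 0" using set_bits[of c] by (auto simp: count_list_0_iff)
  then show ?case using Cons by (simp add: toks_Cons)
qed simp

lemma run_count_candidates:
  assumes s: "s 3 = toks cs" "s 7 = []" "s 8 = []" "s 9 = []" and w: "word N (toks cs)"
  shows "run N count_candidates s = Some (s(7 := replicate (length cs - 1) 1))"
proof -
  define c where "c = (Test (\<lambda>t. t 9 = 3) (put 7 1) Skip ;; Pop 9)"
  have loop: "iter k (\<lambda>s. hd0 (s 9) \<noteq> 0) (run N c) s =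
      Some (s(9 := [], 7 := replicate (count_list xs 3 + h) 1))"
    if "word k xs" "s 9 = xs" "s 7 = replicate h 1" for k s h xs
    using that
  proof (induction xs arbitrary: s h k)
    case Nil
    then show ?case by (cases k) (simp_all add: fun_upd_idem)
  next
    case (Cons x xs)
    then obtain k' where k: "k = Suc k'" "word k' xs" "x \<noteq> 0" by (cases k) (auto simp: word_def)
    define h' where "h' = (if x = 3 then Suc h else h)"
    have "run N c s = Some (s(9 := xs, 7 := replicate h' 1))"
      using Cons.prems unfolding c_def h'_def by (simp add: tops_apply fun_upd_twist fun_upd_idem)
    moreover have eq: "count_list xs 3 + h' = count_list (x # xs) 3 + h" by (simp add: h'_def)
    ultimately show ?case
      using Cons.prems k Cons.IH[of k' "s(9 := xs, 7 := replicate h' 1)" h']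
      unfolding eq by (simp add: fun_upd_twist del: count_list.simps)
  qed
  have "tl (replicate (length cs) 1) = replicate (length cs - 1) (1::nat)" by (cases cs) simp_all
  then show ?thesis
    using s w loop[of N "toks cs" "s(9 := toks cs)" 0] unfolding count_candidates_def c_def[symmetric]
    by (simp add: tops_apply run_copy count_list_toks fun_upd_twist fun_upd_idem)
qed

definition check_valid :: com where
  "check_valid = copy 3 9 8 ;; check_members 3 ;; copy 4 10 8 ;; check_member 3 ;; clear 10 ;; check_votes"

lemma run_check_valid:
  assumes s: "s 0 = vote_word vs r" "s 3 = toks cs" "s 4 = bits p" "s 26 = []"
    and e: "s 8 = []" "s 9 = []" "s 10 = []" "s 11 = []" "s 12 = []" "s 13 = []" "s 14 = []"
      "s 15 = []" "s 16 = []" "s 17 = []"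
    and w: "word N (vote_word vs r)" "word N (toks cs)" "word N (bits p)"
  shows "run N check_valid s = Some (s(26 := flag ((\<forall>x \<in> set cs. count_list cs x = 1) \<and>
    count_list cs p = 1 \<and> (\<forall>a \<in> set vs. valid_vote cs a))))"
proof -
  have "s 26 = flag True" using s(4) by (simp add: flag_def)
  then show ?thesis
    using s(1-3) e w unfolding check_valid_def
    by (simp add: run_copy run_clear run_check_members[where xs = cs and ys = cs and b = True]
        run_check_member[where x = p and ys = cs and b = "\<forall>x \<in> set cs. count_list cs x = 1"]
        run_check_votes[where cs = cs and vs = vs and r = r and
          b = "(\<forall>x \<in> set cs. count_list cs x = 1) \<and> count_list cs p = 1"]
        conj_assoc fun_upd_twist fun_upd_idem)
qed

definition score_favourite :: com where
  "score_favourite = copy 4 10 8 ;; copy 0 16 8 ;; add_score ;; Pop 16 ;; Pop 16 ;; add_tops ;;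
     clear 16 ;; clear 10 ;; copy 18 23 8 ;; clear 18"

lemma run_score_favourite:
  assumes s: "s 0 = vote_word vs (4 # weight_word ws)" "s 4 = bits p" "s 7 = replicate m 1"
    and e: "s 8 = []" "s 10 = []" "s 11 = []" "s 13 = []" "s 14 = []" "s 15 = []" "s 16 = []"
      "s 17 = []" "s 18 = []" "s 19 = []" "s 20 = []" "s 21 = []" "s 22 = []" "s 23 = []"
    and w: "word N (vote_word vs (4 # weight_word ws))" "word N (bits p)" "m \<le> N"
    and b: "\<forall>(w, v) \<in> set vs. place_points m v p \<le> N"
      "vote_score m vs p + m * sum_list ws < 2 ^ N"
  shows "run N score_favourite s = Some (s(23 := digits (vote_score m vs p + m * sum_list ws)))"
proof -
  have "word N (weight_word ws)" "word N [5]" using w(1) by (auto simp: vote_word_def word_def)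
  then show ?thesis
    using s e w b unfolding score_favourite_def
    by (simp add: run_copy run_clear word_digits
        run_add_score[where vs = vs and r = "4 # weight_word ws" and x = p and m = m and y = 0]
        run_add_tops[where ws = ws and m = m and y = "vote_score m vs p"]
        fun_upd_twist fun_upd_idem)
qed

definition compare_all :: com where
  "compare_all = copy 3 9 8 ;; Loop (\<lambda>t. t 9 \<noteq> 0)
     (token 3 9 10 8 ;; copy 0 16 8 ;; add_score ;; clear 16 ;; clear 10 ;; copy 23 24 8 ;; check_le)"

lemma run_compare_all:
  assumes s: "s 0 = vote_word vs r" "s 3 = toks cs" "s 7 = replicate m 1" "s 23 = digits y"
      "s 26 = flag b"
    and e: "s 8 = []" "s 9 = []" "s 10 = []" "s 11 = []" "s 13 = []" "s 14 = []" "s 15 = []"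
      "s 16 = []" "s 17 = []" "s 18 = []" "s 19 = []" "s 20 = []" "s 21 = []" "s 22 = []"
      "s 24 = []" "s 25 = []"
    and w: "word N (vote_word vs r)" "word N (toks cs)" "m \<le> N"
    and b: "\<And>x. \<forall>(w, v) \<in> set vs. place_points m v x \<le> N"
      "\<And>x. vote_score m vs x < 2 ^ N" "y < 2 ^ N"
  shows "run N compare_all s = Some (s(26 := flag (b \<and> (\<forall>x \<in> set cs. vote_score m vs x \<le> y))))"
proof -
  define c where "c = (token 3 9 10 8 ;; copy 0 16 8 ;; add_score ;; clear 16 ;; clear 10 ;;
      copy 23 24 8 ;; check_le)"
  have w5: "word N (5 # r)" using w(1) by (auto simp: vote_word_def word_def)
  have loop: "iter k (\<lambda>s. hd0 (s 9) \<noteq> 0) (run N c) s =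
      Some (s(9 := [], 26 := flag (b \<and> (\<forall>x \<in> set cs. vote_score m vs x \<le> y))))"
    if "length cs \<le> k" "s 9 = toks cs" "s 0 = vote_word vs r" "s 7 = replicate m 1" "s 23 = digits y"
      "s 26 = flag b" "s 8 = []" "s 10 = []" "s 11 = []" "s 13 = []" "s 14 = []" "s 15 = []"
      "s 16 = []" "s 17 = []" "s 18 = []" "s 19 = []" "s 20 = []" "s 21 = []" "s 22 = []"
      "s 24 = []" "s 25 = []" "word N (toks cs)" for k s
    using that
  proof (induction cs arbitrary: s b k)
    case Nil
    then show ?case by (cases k) (simp_all add: fun_upd_idem)
  next
    case (Cons x xs)
    then obtain k' where k: "k = Suc k'" "length xs \<le> k'" by (cases k) auto
    note wx = word_toks_Cons[OF Cons.prems(22)]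
    have "run N c s = Some (s(9 := toks xs, 26 := flag (b \<and> vote_score m vs x \<le> y)))"
      using Cons.prems wx w(1,3) w5 b word_lengthD[of N "bits x"] unfolding c_def
      by (simp add: run_token run_copy run_clear toks_Cons word_digits
          run_add_score[where vs = vs and r = r and x = x and m = m and y = 0]
          run_check_le[where x = "vote_score m vs x" and y = y and b = b]
          fun_upd_twist fun_upd_idem)
    moreover have "hd0 (s 9) \<noteq> 0" using Cons.prems(2) hd0_toks_Cons by simp
    ultimately show ?case
      using Cons.prems k wx Cons.IH[of k' "s(9 := toks xs, 26 := flag (b \<and> vote_score m vs x \<le> y))"
        "b \<and> vote_score m vs x \<le> y"]
      by (simp add: fun_upd_twist conj_assoc)
  qed
  have "length cs \<le> N" using length_le_toks[of cs] w(2) by (simp add: word_def)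
  then show ?thesis
    using s e w loop[of N "s(9 := toks cs)"] unfolding compare_all_def c_def[symmetric]
    by (simp add: tops_apply run_copy fun_upd_twist fun_upd_idem)
qed

definition parse :: com where
  "parse = Pop 0 ;; token 5 0 3 8 ;; token 3 0 4 8 ;; Pop 0"

definition decide_instance :: com where
  "decide_instance = parse ;; count_candidates ;; check_valid ;; score_favourite ;; compare_all"

lemma encode_eq:
  "encode I = 4 # toks (cands I) @ 5 # bits (favourite I) @ 3 # 4 #
     vote_word (votes I) (4 # weight_word (coalition I))"
  by (simp add: encode_def enc_list_def toks_def enc_bits_eq vote_word_def weight_word_def)

definition accepted :: "manip_instance \<Rightarrow> bool" where
  "accepted I \<longleftrightarrow> (let m = length (cands I) - 1 in
     (\<forall>x \<in> set (cands I). count_list (cands I) x = 1) \<and> count_list (cands I) (favourite I) = 1 \<and>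
     (\<forall>a \<in> set (votes I). valid_vote (cands I) a) \<and>
     (\<forall>x \<in> set (cands I). vote_score m (votes I) x \<le>
        vote_score m (votes I) (favourite I) + m * sum_list (coalition I)))"

text \<open>A repetition-free ranking earns at most \<open>m\<close>, but votes not yet known to be
  valid must be covered too, and there each occurrence of \<open>x\<close> may contribute up to
  \<open>m\<close>.\<close>

lemma place_points_le: "place_points m v x \<le> m * length v"
proof (induction v arbitrary: m)
  case (Cons y v)
  have "place_points (m - 1) v x \<le> m * length v"
    using Cons[of "m - 1"] by (meson diff_le_self le_trans mult_le_mono1)
  then show ?case by simp
qed simp

section \<open>Size bounds for scores\<close>

lemma sum_less_power:
  assumes "a < 2 ^ i" "b < 2 ^ j" "i + j < k"
  shows "a + b < (2::nat) ^ k"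
proof -
  have "(2::nat) ^ i \<le> 2 ^ (k - 1)" "(2::nat) ^ j \<le> 2 ^ (k - 1)"
    using assms(3) by (intro power_increasing; simp)+
  moreover have "(2::nat) ^ k = 2 ^ (k - 1) + 2 ^ (k - 1)" using assms(3) by (cases k) simp_all
  ultimately show ?thesis using assms(1,2) by linarith
qed

lemma less_power_digits: "w < 2 ^ length (digits w)"
  using length_digits[of w "length (digits w)"] by simp

lemma mult_less_power: "a < 2 ^ i \<Longrightarrow> b < 2 ^ j \<Longrightarrow> a * b < (2::nat) ^ (i + j)"
  by (cases "b = 0") (simp, simp add: power_add mult_strict_mono)

text \<open>A weight is below 2 to the number of its digits, so products are bounded by adding
  exponents. The delimiters in the encoding of each vote provide the extra exponent that absorbs the
  addition.\<close>

lemma vote_score_less: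
  assumes "\<forall>(w, v) \<in> set vs. place_points m v x < 2 ^ p"
  shows "vote_score m vs x < 2 ^ (p + length (vote_word vs r))"
  using assms
proof (induction vs)
  case (Cons a vs)
  obtain w v where a: "a = (w, v)" by fastforce
  have "place_points m v x * w < 2 ^ (p + length (digits w))"
    using Cons.prems a by (intro mult_less_power less_power_digits) simp
  moreover have "vote_score m vs x < 2 ^ (p + length (vote_word vs r))" using Cons by simp
  moreover have "(2::nat) ^ (p + length (digits w)) \<le> 2 ^ (p + length (digits w) + length (vote_word vs r))"
    "(2::nat) ^ (p + length (vote_word vs r)) \<le> 2 ^ (p + length (digits w) + length (vote_word vs r))"
    by (intro power_increasing; simp)+
  ultimately have "vote_score m (a # vs) x <
      2 * 2 ^ (p + length (digits w) + length (vote_word vs r))"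
    unfolding a vote_score_simps by linarith
  also have "\<dots> = 2 ^ Suc (p + length (digits w) + length (vote_word vs r))" by simp
  also have "\<dots> \<le> 2 ^ (p + length (vote_word (a # vs) r))"
    by (intro power_increasing) (simp_all add: a vote_word_Cons)
  finally show ?case .
qed simp

lemma sum_list_less: "sum_list ws < 2 ^ length (weight_word ws)"
proof (induction ws)
  case (Cons w ws)
  show ?case
    using sum_less_power[OF less_power_digits Cons, of w "length (weight_word (w # ws))"]
    by (simp add: weight_word_Cons)
qed simp

lemma length_vote_le:
  assumes "(w, v) \<in> set vs"
  shows "length v \<le> length (vote_word vs r)"
  using assms
proof (induction vs)
  case (Cons a vs)
  then show ?case using length_le_toks[of v] by (cases a) (auto simp: vote_word_Cons)
qed simp

lemma run_decide_instance:
  fixes I :: manip_instance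
  assumes s: "s 0 = encode I" "\<And>r. r \<noteq> 0 \<Longrightarrow> r \<noteq> 2 \<Longrightarrow> s r = []"
    and N: "N = 1 + length (encode I) + length (encode I) * length (encode I)"
  shows "\<exists>s'. run N decide_instance s = Some s' \<and> s' 26 = flag (accepted I)"
proof -
  let ?n = "length (encode I)"
  let ?cs = "cands I" let ?p = "favourite I" let ?vs = "votes I" let ?ws = "coalition I"
  let ?r = "4 # weight_word ?ws" let ?m = "length ?cs - 1"
  have n: "length (toks ?cs) + length (bits ?p) + length (vote_word ?vs ?r) + 4 = ?n"
    by (simp add: encode_eq)
  have nr: "length (weight_word ?ws) < length (vote_word ?vs ?r)" by (simp add: vote_word_def)
  have "0 \<notin> set (vote_word ?vs ?r)"
  proof -
    have "0 \<notin> set (enc_vote a)" for a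
      using set_toks[of "snd a"] set_digits[of "fst a"]
      by (cases a) (auto simp: enc_vote_def enc_nat_eq enc_list_def toks_def)
    moreover have "0 \<notin> set (enc_nat a)" for a using set_digits[of a] by (auto simp: enc_nat_eq)
    ultimately show ?thesis by (auto simp: vote_word_def weight_word_def)
  qed
  then have w: "word N (vote_word ?vs ?r)" "word N (toks ?cs)" "word N (bits ?p)"
    using n N set_toks[of ?cs] set_bits[of ?p] by (auto simp: word_def)
  have m: "?m \<le> ?n" using length_le_toks[of ?cs] n by simp
  have pp: "place_points ?m v x \<le> ?n * ?n" if "(u, v) \<in> set ?vs" for u v x
  proof -
    have "length v \<le> ?n" using length_vote_le[OF that, of ?r] n by linarith
    then have "?m * length v \<le> ?n * ?n" using m by (rule mult_le_mono[rotated])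
    then show ?thesis using place_points_le[of ?m v x] by linarith
  qed
  have b1: "\<forall>(u, v) \<in> set ?vs. place_points ?m v x \<le> N" for x
  proof clarify
    fix u v assume "(u, v) \<in> set ?vs"
    from pp[OF this, of x] N show "place_points ?m v x \<le> N" by simp
  qed
  \<comment> \<open>Both parts of the score to beat lie below this power, with
    \<open>?n * ?n\<close> as a crude exponent for the points. Their sum costs one doubling, which
    the summand \<open>1\<close> of \<open>N\<close> pays for.\<close>
  let ?q = "2 ^ (?n * ?n + (length (vote_word ?vs ?r))) :: nat"
  have "\<forall>(u, v) \<in> set ?vs. place_points ?m v x < 2 ^ (?n * ?n)" for x
  proof clarify
    fix u v assume "(u, v) \<in> set ?vs"
    from pp[OF this, of x] less_exp[of "?n * ?n"] show "place_points ?m v x < 2 ^ (?n * ?n)"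
      by linarith
  qed
  then have vs: "vote_score ?m ?vs x < ?q" for x by (rule vote_score_less)
  have "?n \<le> ?n * ?n" by (cases ?n) simp_all
  then have "?m < 2 ^ (?n * ?n)" using m less_exp[of "?n * ?n"] by linarith
  then have "?m * sum_list ?ws < 2 ^ (?n * ?n + length (weight_word ?ws))"
    by (rule mult_less_power[OF _ sum_list_less])
  also have "\<dots> \<le> ?q" using nr by (intro power_increasing) simp_all
  finally have "?m * sum_list ?ws < ?q" .
  then have "vote_score ?m ?vs ?p + ?m * sum_list ?ws < 2 * ?q" using vs[of ?p] by linarith
  also have "\<dots> = 2 ^ Suc (?n * ?n + (length (vote_word ?vs ?r)))" by simp
  also have "\<dots> \<le> 2 ^ N" unfolding N using n by (intro power_increasing) simp_all
  finally have b2: "vote_score ?m ?vs ?p + ?m * sum_list ?ws < 2 ^ N" .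
  have "?q \<le> 2 ^ N" unfolding N using n by (intro power_increasing) simp_all
  then have b3: "vote_score ?m ?vs x < 2 ^ N" for x using vs[of x] by linarith
  have mN: "?m \<le> N" using m N by simp
  have lN: "length (toks ?cs) \<le> N" "length (bits ?p) \<le> N" using w by (auto simp: word_def)
  let ?s1 = "s(0 := vote_word ?vs ?r, 3 := toks ?cs, 4 := bits ?p)"
  have 1: "run N parse s = Some ?s1"
    using s lN unfolding parse_def
    by (simp add: encode_eq run_token fun_upd_twist)
  let ?s2 = "?s1(7 := replicate ?m 1)"
  have 2: "run N count_candidates ?s1 = Some ?s2"
    by (rule run_count_candidates) (use s w in simp_all)
  define g where "g \<longleftrightarrow> (\<forall>x \<in> set ?cs. count_list ?cs x = 1) \<and> count_list ?cs ?p = 1 \<and>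
    (\<forall>a \<in> set ?vs. valid_vote ?cs a)"
  let ?s3 = "?s2(26 := flag g)"
  have 3: "run N check_valid ?s2 = Some ?s3"
    unfolding g_def by (rule run_check_valid[where r = ?r]) (use s w in simp_all)
  let ?y = "vote_score ?m ?vs ?p + ?m * sum_list ?ws"
  let ?s4 = "?s3(23 := digits ?y)"
  have 4: "run N score_favourite ?s3 = Some ?s4"
    by (rule run_score_favourite) (use s w mN b1 b2 in simp_all)
  have 5: "run N compare_all ?s4 = Some (?s4(26 := flag (g \<and> (\<forall>x \<in> set ?cs. vote_score ?m ?vs x \<le> ?y))))"
    by (rule run_compare_all[where r = ?r]) (use s w mN b1 b2 b3 in simp_all)
  have "accepted I \<longleftrightarrow> g \<and> (\<forall>x \<in> set ?cs. vote_score ?m ?vs x \<le> ?y)"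
    unfolding accepted_def g_def Let_def by blast
  then show ?thesis using 1 2 3 4 5 unfolding decide_instance_def by simp
qed

section \<open>Optimal manipulation\<close>

lemma distinct_iff_count_list: "distinct xs \<longleftrightarrow> (\<forall>x \<in> set xs. count_list xs x = 1)"
proof (induction xs)
  case (Cons y xs)
  have "count_list xs y + 1 = 1 \<longleftrightarrow> y \<notin> set xs" by (simp add: count_list_0_iff)
  then show ?case using Cons by auto
qed simp

lemma distinct_count_list: "distinct xs \<Longrightarrow> count_list xs x = (if x \<in> set xs then 1 else 0)"
  using distinct_iff_count_list[of xs] by (simp add: count_list_0_iff)

lemma valid_vote_iff:
  assumes "distinct cs"
  shows "valid_vote cs (w, v) \<longleftrightarrow> is_vote (set cs) v"
  using assms by (auto simp: valid_vote_def is_vote_def distinct_count_list distinct_iff_count_list[of v])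

lemma place_points_eq:
  "distinct v \<Longrightarrow> place_points k v c =
    (if c \<in> set v then k - length (takeWhile (\<lambda>d. d \<noteq> c) v) else 0)"
proof (induction v arbitrary: k)
  case (Cons y v)
  then show ?case by (auto simp: One_nat_def)
qed simp

lemma points_up_eq:
  assumes "distinct v"
  shows "points_up C v c = place_points (card C - 1) v c"
  using assms by (simp add: points_up_def place_points_eq borda_def rank_def add.commute)

lemma points_up_le: "points_up C v c \<le> card C - 1"
  by (auto simp: points_up_def borda_def rank_def)

lemma score_up_eq: "score_up C vs c = (\<Sum>(w, v) \<leftarrow> vs. points_up C v c * w)"
proof (induction vs)
  case (Cons a vs)
  then show ?case
    by (cases a) (simp add: score_up_def unweighted_def sum_list_replicate map_replicate)
qed (simp add: score_up_def unweighted_def)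

lemma score_up_append: "score_up C (vs @ us) c = score_up C vs c + score_up C us c"
  by (simp add: score_up_eq)

lemma score_up_zip_le:
  assumes "length vs = length ws"
  shows "score_up C (zip ws vs) c \<le> (card C - 1) * sum_list ws"
  using assms
proof (induction vs ws rule: list_induct2)
  case (Cons v vs w ws)
  have "points_up C v c * w \<le> (card C - 1) * w" by (rule mult_le_mono1[OF points_up_le])
  then show ?case using Cons
    by (simp add: score_up_eq distrib_left add_le_mono del: mult_le_cancel2)
qed (simp add: score_up_eq)

lemma score_up_top:
  "score_up C (zip ws (replicate (length ws) [p])) c = (if c = p then (card C - 1) * sum_list ws else 0)"
proof (induction ws)
  case (Cons w ws)
  then show ?case by (auto simp: score_up_eq points_up_def borda_def rank_def distrib_left)
qed (simp add: score_up_eq)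

lemma manipulable_up_iff:
  assumes "favourite I \<in> set (cands I)"
  shows "manipulable_up I \<longleftrightarrow> (\<forall>c \<in> set (cands I). score_up (set (cands I)) (votes I) c \<le>
    score_up (set (cands I)) (votes I) (favourite I) + (card (set (cands I)) - 1) * sum_list (coalition I))"
    (is "_ \<longleftrightarrow> (\<forall>c \<in> ?C. ?sc c \<le> ?sc ?p + ?k)")
proof
  assume "manipulable_up I"
  then obtain vs where vs: "length vs = length (coalition I)"
    "wins_up ?C (votes I @ zip (coalition I) vs) ?p"
    by (auto simp: manipulable_up_def)
  show "\<forall>c \<in> ?C. ?sc c \<le> ?sc ?p + ?k"
  proof
    fix c assume "c \<in> ?C"
    then have "?sc c + score_up ?C (zip (coalition I) vs) c \<le>
        ?sc ?p + score_up ?C (zip (coalition I) vs) ?p"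
      using vs(2) by (simp add: wins_up_def score_up_append)
    then show "?sc c \<le> ?sc ?p + ?k" using score_up_zip_le[OF vs(1), of ?C ?p] by linarith
  qed
next
  assume *: "\<forall>c \<in> ?C. ?sc c \<le> ?sc ?p + ?k"
  let ?vs = "replicate (length (coalition I)) [?p]"
  have "wins_up ?C (votes I @ zip (coalition I) ?vs) ?p"
    using * by (simp add: wins_up_def score_up_append score_up_top)
  moreover have "\<forall>v \<in> set ?vs. is_vote ?C v" using assms by (simp add: is_vote_def)
  ultimately show "manipulable_up I" unfolding manipulable_up_def
    by (intro exI[of _ ?vs]) simp
qed

definition positive_weights :: "manip_instance \<Rightarrow> bool" where
  "positive_weights I \<longleftrightarrow> (\<forall>a \<in> set (votes I). fst a \<noteq> 0) \<and> (\<forall>w \<in> set (coalition I). w \<noteq> 0)"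

lemma vote_score_eq:
  assumes "\<forall>a \<in> set vs. is_vote C (snd a)"
  shows "vote_score (card C - 1) vs c = score_up C vs c"
  using assms
proof (induction vs)
  case (Cons a vs)
  then show ?case by (cases a) (simp add: score_up_eq points_up_eq is_vote_def)
qed (simp add: score_up_eq)

lemma accepted_iff:
  assumes "positive_weights I"
  shows "accepted I \<longleftrightarrow> valid_instance I \<and> manipulable_up I"
proof (cases "distinct (cands I) \<and> favourite I \<in> set (cands I) \<and>
    (\<forall>a \<in> set (votes I). is_vote (set (cands I)) (snd a))")
  case True
  have "valid_instance I"
    using True assms by (force simp: valid_instance_def positive_weights_def)
  moreover have "\<forall>a \<in> set (votes I). valid_vote (cands I) a"
    using True valid_vote_iff[of "cands I"] by (metis prod.collapse)
  moreover have "card (set (cands I)) = length (cands I)" using True by (simp add: distinct_card)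
  ultimately show ?thesis
    using True vote_score_eq[of "votes I" "set (cands I)"]
      distinct_count_list[of "cands I"] manipulable_up_iff[of I]
    by (simp add: accepted_def Let_def)
next
  \<comment> \<open>Here the numbers compared in \<open>accepted\<close> need not be Borda scores,
    but both sides already fail on validity.\<close>
  case False
  have "\<not> accepted I"
  proof
    assume acc: "accepted I"
    then have d: "distinct (cands I)" by (simp add: accepted_def Let_def distinct_iff_count_list)
    moreover have "favourite I \<in> set (cands I)"
      using acc d by (auto simp: accepted_def Let_def distinct_count_list split: if_splits)
    moreover have "\<forall>a \<in> set (votes I). is_vote (set (cands I)) (snd a)"
      using acc valid_vote_iff[OF d] by (metis accepted_def prod.collapse)
    ultimately show False using False by simp
  qed
  moreover have "\<not> valid_instance I"
    using False by (auto simp: valid_instance_def)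
  ultimately show ?thesis by simp
qed

section \<open>Recognising encodings\<close>

text \<open>A finite automaton for the words \<^term>\<open>encode I\<close> with positive weights; 15 is the final state
  and 16 a trap. In the states 7 and 14 (6 and 13) the last bit of the weight being read was 1 (0),
  which excludes leading zeros and the weight 0.\<close>

definition transitions :: "((nat \<times> nat) \<times> nat) list" where
  "transitions =
    [((0, 4), 1),
     ((1, 5), 3), ((1, 3), 1), ((1, 1), 2), ((1, 2), 2),
     ((2, 1), 2), ((2, 2), 2), ((2, 3), 1),
     ((3, 1), 3), ((3, 2), 3), ((3, 3), 4),
     ((4, 4), 5),
     ((5, 5), 11), ((5, 1), 6), ((5, 2), 7),
     ((6, 1), 6), ((6, 2), 7),
     ((7, 1), 6), ((7, 2), 7), ((7, 3), 8),
     ((8, 4), 9),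
     ((9, 5), 5), ((9, 3), 9), ((9, 1), 10), ((9, 2), 10),
     ((10, 1), 10), ((10, 2), 10), ((10, 3), 9),
     ((11, 4), 12),
     ((12, 5), 15), ((12, 1), 13), ((12, 2), 14),
     ((13, 1), 13), ((13, 2), 14),
     ((14, 1), 13), ((14, 2), 14), ((14, 3), 12)]"

definition syntax_step :: "nat \<Rightarrow> nat \<Rightarrow> nat" where
  "syntax_step q a = (case map_of transitions (q, a) of None \<Rightarrow> 16 | Some q' \<Rightarrow> q')"

lemma syntax_step_less: "syntax_step q a < 17"
proof (cases "map_of transitions (q, a)")
  case (Some q')
  then have "((q, a), q') \<in> set transitions" by (rule map_of_SomeD)
  then show ?thesis using Some by (auto simp: syntax_step_def transitions_def)
qed (simp add: syntax_step_def)

text \<open>The tails of a well-formed word that may follow inside a bit string, inside a list of bit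
  strings, and inside a positive number whose last bit so far is \<open>b\<close>.\<close>

definition name_tail :: "(nat list \<Rightarrow> bool) \<Rightarrow> nat list \<Rightarrow> bool" where
  "name_tail L w \<longleftrightarrow> (\<exists>x r. w = bits x @ 3 # r \<and> L r)"

definition names_tail :: "(nat list \<Rightarrow> bool) \<Rightarrow> nat list \<Rightarrow> bool" where
  "names_tail L w \<longleftrightarrow> (\<exists>xs r. w = toks xs @ 5 # r \<and> L r)"

definition number_tail :: "bool \<Rightarrow> (nat list \<Rightarrow> bool) \<Rightarrow> nat list \<Rightarrow> bool" where
  "number_tail b L w \<longleftrightarrow> (\<exists>x r. w = bits x @ 3 # r \<and> last (b # x) \<and> L r)"

definition weights_tail :: "nat list \<Rightarrow> bool" where
  "weights_tail w \<longleftrightarrow> (\<exists>ws. w = weight_word ws \<and> 0 \<notin> set ws)"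

definition bracket_tail :: "(nat list \<Rightarrow> bool) \<Rightarrow> nat list \<Rightarrow> bool" where
  "bracket_tail L w \<longleftrightarrow> (\<exists>r. w = 4 # r \<and> L r)"

definition votes_tail :: "nat list \<Rightarrow> bool" where
  "votes_tail w \<longleftrightarrow>
     (\<exists>vs r. w = vote_word vs r \<and> (\<forall>a \<in> set vs. fst a \<noteq> 0) \<and> bracket_tail weights_tail r)"

lemma bits_Cons: "bits (b # x) = (if b then 2 else 1) # bits x"
  by (simp add: bits_def)

lemma bits_Nil [simp]: "bits [] = []"
  by (simp add: bits_def)

lemma name_tail_simps:
  "L w \<Longrightarrow> name_tail L (3 # w)"
  "name_tail L w \<Longrightarrow> name_tail L (1 # w)"
  "name_tail L w \<Longrightarrow> name_tail L (2 # w)"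
proof -
  show "L w \<Longrightarrow> name_tail L (3 # w)"
    unfolding name_tail_def by (rule exI[of _ "[]"]) simp
  assume "name_tail L w"
  then obtain x r where "w = bits x @ 3 # r" "L r" by (auto simp: name_tail_def)
  then show "name_tail L (1 # w)" "name_tail L (2 # w)"
    using bits_Cons[of False x] bits_Cons[of True x] unfolding name_tail_def
    by (metis append_Cons)+
qed

lemma names_tail_simps:
  "L w \<Longrightarrow> names_tail L (5 # w)"
  "name_tail (names_tail L) w \<Longrightarrow> names_tail L w"
proof -
  show "L w \<Longrightarrow> names_tail L (5 # w)"
    unfolding names_tail_def by (rule exI[of _ "[]"]) simp
  assume "name_tail (names_tail L) w"
  then obtain x xs r where "w = bits x @ 3 # toks xs @ 5 # r" "L r"
    by (auto simp: name_tail_def names_tail_def)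
  then show "names_tail L w" using toks_Cons[of x xs] unfolding names_tail_def
    by (metis append.assoc append_Cons)
qed

lemma number_tail_simps:
  "L w \<Longrightarrow> number_tail True L (3 # w)"
  "number_tail False L w \<Longrightarrow> number_tail b L (1 # w)"
  "number_tail True L w \<Longrightarrow> number_tail b L (2 # w)"
proof -
  show "L w \<Longrightarrow> number_tail True L (3 # w)"
    unfolding number_tail_def by (rule exI[of _ "[]"]) simp
next
  assume "number_tail False L w"
  then obtain x r where "w = bits x @ 3 # r" "last (False # x)" "L r" by (auto simp: number_tail_def)
  then show "number_tail b L (1 # w)"
    unfolding number_tail_def by (intro exI[of _ "False # x"] exI[of _ r]) (simp add: bits_Cons)
next
  assume "number_tail True L w"
  then obtain x r where "w = bits x @ 3 # r" "last (True # x)" "L r" by (auto simp: number_tail_def)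
  then show "number_tail b L (2 # w)"
    unfolding number_tail_def by (intro exI[of _ "True # x"] exI[of _ r]) (simp add: bits_Cons)
qed

text \<open>The last bit is the most significant, so ending in \<open>True\<close> excludes leading
  zeros. Without this the automaton could accept numerals that encode no number.\<close>

lemma binary_surj: "x = [] \<or> last x \<Longrightarrow> \<exists>n. binary n = x"
proof (induction x)
  case Nil
  show ?case by (rule exI[of _ 0]) (simp add: binary.simps)
next
  case (Cons b x)
  then obtain n where n: "binary n = x" by (auto split: if_splits)
  have "n \<noteq> 0 \<or> b" using n Cons.prems by (auto simp: binary.simps[of 0])
  then have "binary (2 * n + (if b then 1 else 0)) = b # x"
    using n by (subst binary.simps) auto
  then show ?case by blast
qed

lemma number_tail_digits:
  assumes "number_tail False L w"
  shows "\<exists>n r. n \<noteq> 0 \<and> w = digits n @ 3 # r \<and> L r"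
proof -
  obtain x r where x: "w = bits x @ 3 # r" "x \<noteq> []" "last x" "L r"
    using assms by (auto simp: number_tail_def split: if_splits)
  obtain n where n: "binary n = x" using binary_surj x(3) by blast
  have "n \<noteq> 0" using n x(2) by (cases "n = 0") (simp_all add: binary.simps[of 0])
  moreover have "w = digits n @ 3 # r" using x(1) n by (simp add: digits_def)
  ultimately show ?thesis using x(4) by blast
qed

lemma weights_tail_simps:
  "weights_tail [5]"
  "number_tail False weights_tail w \<Longrightarrow> weights_tail w"
proof -
  show "weights_tail [5]" unfolding weights_tail_def by (rule exI[of _ "[]"]) simp
  assume "number_tail False weights_tail w"
  then obtain n ws where "n \<noteq> 0" "w = digits n @ 3 # weight_word ws" "0 \<notin> set ws"
    using number_tail_digits[of weights_tail w] unfolding weights_tail_def by blast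
  then show "weights_tail w"
    unfolding weights_tail_def by (intro exI[of _ "n # ws"]) (simp add: weight_word_Cons)
qed

lemma votes_tail_simps:
  "bracket_tail weights_tail w \<Longrightarrow> votes_tail (5 # w)"
  "number_tail False (bracket_tail (names_tail votes_tail)) w \<Longrightarrow> votes_tail w"
proof -
  show "bracket_tail weights_tail w \<Longrightarrow> votes_tail (5 # w)"
    unfolding votes_tail_def by (rule exI[of _ "[]"]) simp
  assume "number_tail False (bracket_tail (names_tail votes_tail)) w"
  then obtain n r where n: "n \<noteq> 0" "w = digits n @ 3 # r" "bracket_tail (names_tail votes_tail) r"
    using number_tail_digits by blast
  obtain v vs r' where "r = 4 # toks v @ 5 # vote_word vs r'" "\<forall>a \<in> set vs. fst a \<noteq> 0"
    "bracket_tail weights_tail r'"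
    using n(3) unfolding bracket_tail_def names_tail_def votes_tail_def by blast
  then show "votes_tail w"
    unfolding votes_tail_def
    by (intro exI[of _ "(n, v) # vs"] exI[of _ r']) (simp add: vote_word_Cons n(1,2))
qed

text \<open>What may still follow in state \<open>q\<close>; \<open>L3\<close> and \<open>L8\<close>
  are named after their states. The trap gets the empty language.\<close>

definition tail_language :: "nat \<Rightarrow> nat list \<Rightarrow> bool" where
  "tail_language q =
    (let L8 = bracket_tail (names_tail votes_tail);
         L3 = name_tail (bracket_tail votes_tail)
     in if q = 0 then bracket_tail (names_tail L3)
        else if q = 1 then names_tail L3
        else if q = 2 then name_tail (names_tail L3)
        else if q = 3 then L3
        else if q = 4 then bracket_tail votes_tail
        else if q = 5 then votes_tail
        else if q = 6 then number_tail False L8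
        else if q = 7 then number_tail True L8
        else if q = 8 then L8
        else if q = 9 then names_tail votes_tail
        else if q = 10 then name_tail (names_tail votes_tail)
        else if q = 11 then bracket_tail weights_tail
        else if q = 12 then weights_tail
        else if q = 13 then number_tail False weights_tail
        else if q = 14 then number_tail True weights_tail
        else (\<lambda>w. q = 15 \<and> w = []))"

text \<open>A missing transition leads to the trap, where nothing is left to show; each entry of the
  table is matched by unfolding a bracket or by the introduction rules for tails.\<close>

lemma tail_language_step:
  assumes "tail_language (syntax_step q a) w"
  shows "tail_language q (a # w)"
proof (cases "map_of transitions (q, a)")
  case None
  then show ?thesis using assms by (simp add: syntax_step_def tail_language_def)
next
  case (Some q')
  then have "((q, a), q') \<in> set transitions" "tail_language q' w"
    using assms map_of_SomeD[OF Some] by (simp_all add: syntax_step_def)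
  then show ?thesis
    by (simp add: transitions_def)
      (elim disjE; clarsimp simp: tail_language_def Let_def;
       (auto simp: bracket_tail_def intro: name_tail_simps names_tail_simps number_tail_simps
          weights_tail_simps votes_tail_simps)[1])
qed

lemma syntax_sound: "foldl syntax_step q w = 15 \<Longrightarrow> tail_language q w"
proof (induction w arbitrary: q)
  case Nil
  then show ?case by (simp add: tail_language_def Let_def)
next
  case (Cons a w)
  then show ?case by (intro tail_language_step) simp
qed

section \<open>Encodings drive the automaton to its final state\<close>

lemma last_binary: "n \<noteq> 0 \<Longrightarrow> binary n \<noteq> [] \<and> last (binary n)"
proof (induction n rule: less_induct)
  case (less n)
  show ?case
  proof (cases "n div 2 = 0")
    case True
    then have "n = 1" using less.prems by simp
    then show ?thesis by (simp add: binary.simps[of 1] binary.simps[of 0])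
  next
    case False
    then have "binary (n div 2) \<noteq> [] \<and> last (binary (n div 2))" using less by simp
    then show ?thesis using less.prems by (simp add: binary.simps[of n])
  qed
qed

lemmas syntax_simps = syntax_step_def transitions_def

lemma foldl_bits:
  "q = 2 \<or> q = 3 \<or> q = 10 \<Longrightarrow> foldl syntax_step q (bits x) = q"
proof (induction x)
  case (Cons b x)
  then have "syntax_step q (if b then 2 else 1) = q" by (auto simp: syntax_simps)
  then show ?case using Cons by (simp add: bits_Cons)
qed simp

lemma foldl_toks:
  assumes "q = 1 \<or> q = 9"
  shows "foldl syntax_step q (toks xs) = q"
proof (induction xs)
  case (Cons x xs)
  have "foldl syntax_step q (bits x @ [3]) = q"
  proof (cases x)
    case Nil
    then show ?thesis using assms by (auto simp: syntax_simps)
  next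
    case (Cons b y)
    \<comment> \<open>The state inside a nonempty name, where, unlike between names, a closing
      bracket is an error.\<close>
    let ?q = "if q = 1 then 2 else 10 :: nat"
    have "syntax_step q (if b then 2 else 1) = ?q" "syntax_step ?q 3 = q"
      using assms by (auto simp: syntax_simps)
    then show ?thesis using Cons foldl_bits[of ?q y] by (simp add: bits_Cons del: if_split)
  qed
  then show ?case using Cons by (simp add: toks_Cons)
qed simp

lemma foldl_number:
  fixes q0 q1 :: nat
  assumes "(q0, q1) = (6, 7) \<or> (q0, q1) = (13, 14)"
  shows "foldl syntax_step (if b then q1 else q0) (bits x) = (if last (b # x) then q1 else q0)"
proof (induction x arbitrary: b)
  case (Cons c x)
  have "syntax_step (if b then q1 else q0) (if c then 2 else 1) = (if c then q1 else q0)"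
    using assms by (auto simp: syntax_simps)
  then show ?case using Cons[of c] by (simp add: bits_Cons del: if_split)
qed simp

lemma foldl_digits:
  fixes q q0 q1 :: nat
  assumes "(q, q0, q1) = (5, 6, 7) \<or> (q, q0, q1) = (12, 13, 14)" "n \<noteq> 0"
  shows "foldl syntax_step q (digits n) = q1"
proof -
  obtain b x where bx: "binary n = b # x" "last (b # x)" using last_binary[OF assms(2)]
    by (cases "binary n") auto
  have "syntax_step q (if b then 2 else 1) = (if b then q1 else q0)"
    using assms(1) by (auto simp: syntax_simps)
  then show ?thesis
    using foldl_number[of q0 q1 b x] assms(1) bx by (auto simp: digits_def bits_Cons simp del: if_split)
qed

lemma foldl_weight_word: "0 \<notin> set ws \<Longrightarrow> foldl syntax_step 12 (weight_word ws) = 15"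
proof (induction ws)
  case Nil
  show ?case by (simp add: syntax_simps)
next
  case (Cons w ws)
  have "syntax_step 14 3 = 12" by (simp add: syntax_simps)
  then show ?case using Cons foldl_digits[of 12 13 14 w] by (simp add: weight_word_Cons)
qed

lemma foldl_vote_word:
  "\<forall>a \<in> set vs. fst a \<noteq> 0 \<Longrightarrow> foldl syntax_step 5 (vote_word vs r) = foldl syntax_step 11 r"
proof (induction vs)
  case Nil
  show ?case by (simp add: syntax_simps)
next
  case (Cons a vs)
  have "syntax_step 7 3 = 8" "syntax_step 8 4 = 9" "syntax_step 9 5 = 5" by (simp_all add: syntax_simps)
  then show ?case
    using Cons foldl_digits[of 5 6 7 "fst a"] foldl_toks[of 9 "snd a"]
    by (cases a) (simp add: vote_word_Cons)
qed

lemma syntax_complete: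
  assumes "positive_weights I"
  shows "foldl syntax_step 0 (encode I) = 15"
proof -
  have "syntax_step 0 4 = 1" "syntax_step 1 5 = 3" "syntax_step 3 3 = 4" "syntax_step 4 4 = 5"
    "syntax_step 11 4 = 12" by (simp_all add: syntax_simps)
  moreover have "0 \<notin> set (coalition I)" using assms by (auto simp: positive_weights_def)
  ultimately show ?thesis
    using assms foldl_toks[of 1 "cands I"] foldl_bits[of 3 "favourite I"]
    by (simp add: encode_eq foldl_vote_word foldl_weight_word positive_weights_def)
qed

lemma syntax_iff: "foldl syntax_step 0 w = 15 \<longleftrightarrow> (\<exists>I. positive_weights I \<and> w = encode I)"
proof
  assume "foldl syntax_step 0 w = 15"
  then have "tail_language 0 w" by (rule syntax_sound)
  then obtain cs p vs ws where "w = 4 # toks cs @ 5 # bits p @ 3 # 4 # vote_word vs (4 # weight_word ws)"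
    and pos: "\<forall>a \<in> set vs. fst a \<noteq> 0" "0 \<notin> set ws"
    unfolding tail_language_def Let_def
    by (auto simp: bracket_tail_def names_tail_def name_tail_def votes_tail_def weights_tail_def)
  then have "w = encode \<lparr>cands = cs, favourite = p, votes = vs, coalition = ws\<rparr>"
    by (simp add: encode_eq)
  moreover have "\<forall>w \<in> set ws. w \<noteq> 0" using pos(2) by metis
  then have "positive_weights \<lparr>cands = cs, favourite = p, votes = vs, coalition = ws\<rparr>"
    using pos(1) by (simp add: positive_weights_def)
  ultimately show "\<exists>I. positive_weights I \<and> w = encode I" by blast
qed (use syntax_complete in blast)

section \<open>The complete program\<close>

definition manipulation_program :: com where
  "manipulation_program = copy 0 9 8 ;;
     Loop (\<lambda>t. t 9 \<noteq> 0) (Put 2 (\<lambda>t. syntax_step (t 2) (t 9)) ;; Pop 9) ;;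
     Test (\<lambda>t. t 2 = 15) decide_instance (put 26 1)"

text \<open>The tapes are 0 to 26. Automaton states 0 to 16 are stored as symbols on tape 2, so the
  alphabet must contain them besides the input letters; 20 leaves room.\<close>

lemma wf_manipulation_program: "wf_com 27 20 manipulation_program"
proof -
  have "symbol_fun 20 (\<lambda>t. syntax_step (t 2) (t 9))"
    unfolding symbol_fun_def
  proof (intro allI impI)
    show "syntax_step (t 2) (t 9) < 20" for t using syntax_step_less[of "t 2" "t 9"] by simp
  qed
  then show ?thesis
    by (simp add: manipulation_program_def decide_instance_def parse_def count_candidates_def
        check_valid_def score_favourite_def compare_all_def add_tops_def add_score_def
        count_points_def check_votes_def check_members_def check_member_def count_hits_def
        check_le_def mark_bad_def add_multiple_def add_weight_def add_loop_def equal_def clear_def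
        token_def copy_def move_def put_def put_top_def symbol_fun_def)
qed

lemma run_syntax:
  assumes "word k w" "s 9 = w"
  shows "\<exists>l. run k (Loop (\<lambda>t. t 9 \<noteq> 0) (Put 2 (\<lambda>t. syntax_step (t 2) (t 9)) ;; Pop 9)) s =
    Some (s(9 := [], 2 := l)) \<and> hd0 l = foldl syntax_step (hd0 (s 2)) w"
proof -
  define c where "c = (Put 2 (\<lambda>t. syntax_step (t 2) (t 9)) ;; Pop 9)"
  have "\<exists>l. iter k (\<lambda>s. hd0 (s 9) \<noteq> 0) (run N c) s = Some (s(9 := [], 2 := l)) \<and>
      hd0 l = foldl syntax_step (hd0 (s 2)) w" for N
    using assms
  proof (induction w arbitrary: s k)
    case Nil
    then show ?case by (intro exI[of _ "s 2"]) (cases k; simp add: fun_upd_idem)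
  next
    case (Cons a w)
    then obtain k' where k: "k = Suc k'" "word k' w" "a \<noteq> 0" by (cases k) (auto simp: word_def)
    let ?s = "s(9 := w, 2 := syntax_step (hd0 (s 2)) a # tl (s 2))"
    have "run N c s = Some ?s"
      using Cons.prems unfolding c_def by (simp add: tops_apply fun_upd_twist)
    moreover obtain l where "iter k' (\<lambda>s. hd0 (s 9) \<noteq> 0) (run N c) ?s = Some (?s(9 := [], 2 := l))"
      "hd0 l = foldl syntax_step (hd0 (?s 2)) w"
      using Cons.IH[of k' ?s] k(2) by auto
    ultimately show ?case using Cons.prems k
      by (intro exI[of _ l]) (simp add: fun_upd_twist)
  qed
  then show ?thesis unfolding c_def[symmetric] by (simp add: tops_apply)
qed

lemma set_encode: "set (encode I) \<subseteq> {1..5}"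
proof -
  have "set (enc_vote a) \<subseteq> {1..5}" for a
    using set_toks[of "snd a"] set_digits[of "fst a"]
    by (cases a) (auto simp: enc_vote_def enc_nat_eq enc_list_def toks_def)
  moreover have "set (enc_nat a) \<subseteq> {1..5}" for a using set_digits[of a] by (auto simp: enc_nat_eq)
  ultimately show ?thesis
    using set_toks[of "cands I"] set_bits[of "favourite I"]
    by (fastforce simp: encode_eq vote_word_def weight_word_def)
qed

lemma hd0_flag: "hd0 (flag b) = 0 \<longleftrightarrow> b"
  by (simp add: flag_def)

lemma run_manipulation_program:
  assumes w: "0 \<notin> set w" and N: "N = 1 + length w + length w * length w"
  shows "\<exists>s'. run N manipulation_program (\<lambda>r. if r = 0 then w else []) = Some s' \<and>
    (hd0 (s' 26) = 0 \<longleftrightarrow> w \<in> borda_up_manipulation)"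
proof -
  define s where "s = (\<lambda>r :: nat. if r = 0 then w else [])"
  have s: "s 0 = w" "\<And>r. r \<noteq> 0 \<Longrightarrow> s r = []" by (simp_all add: s_def)
  have word: "word N w" using w N by (simp add: word_def)
  have 1: "run N (copy 0 9 8) s = Some (s(9 := w))"
    using s word by (simp add: run_copy)
  obtain l where l: "run N (Loop (\<lambda>t. t 9 \<noteq> 0) (Put 2 (\<lambda>t. syntax_step (t 2) (t 9)) ;; Pop 9))
      (s(9 := w)) = Some (s(9 := w, 9 := [], 2 := l))" "hd0 l = foldl syntax_step 0 w"
    using run_syntax[OF word, of "s(9 := w)"] s by auto
  let ?s = "s(9 := w, 9 := [], 2 := l)"
  have run: "run N manipulation_program s =
      (if hd0 l = 15 then run N decide_instance ?s else run N (put 26 1) ?s)"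
    using 1 l(1) unfolding manipulation_program_def by (simp only: run.simps tops_apply) simp
  show ?thesis
  proof (cases "hd0 l = 15")
    case True
    then obtain I where I: "positive_weights I" "w = encode I"
      using l(2) syntax_iff[of w] by auto
    have "?s 0 = encode I" "\<And>r. r \<noteq> 0 \<Longrightarrow> r \<noteq> 2 \<Longrightarrow> ?s r = []"
      using s I(2) by (simp_all add: fun_upd_apply)
    then obtain s' where s': "run N decide_instance ?s = Some s'" "s' 26 = flag (accepted I)"
      using run_decide_instance[of ?s I N] N[unfolded I(2)] by blast
    then show ?thesis
      using run True encode_mem_iff[of I] accepted_iff[OF I(1)] I(2)
      by (simp add: s_def[symmetric] hd0_flag)
  next
    case False
    have "w \<notin> borda_up_manipulation"
    proof
      assume "w \<in> borda_up_manipulation"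
      then obtain I where "w = encode I" "valid_instance I"
        by (auto simp: borda_up_manipulation_def)
      moreover from this have "positive_weights I"
        by (auto simp: valid_instance_def positive_weights_def)
      ultimately show False using False l(2) syntax_iff[of w] by auto
    qed
    then show ?thesis using run False by (simp add: s_def[symmetric])
  qed
qed

theorem proposition3: "borda_up_manipulation \<in> polytime 5"
proof (rule polytimeI[OF wf_manipulation_program])
  show "borda_up_manipulation \<subseteq> lists {1..5}"
    using set_encode by (force simp: borda_up_manipulation_def)
  fix w :: "nat list" assume "w \<in> lists {1..5}"
  then have "0 \<notin> set w" by auto
  \<comment> \<open>\<open>[:1, 1, 1:]\<close> is the cap \<open>1 + n + n * n\<close> as a
    polynomial in the input length.\<close>
  then show "\<exists>s'. run (poly [:1, 1, 1:] (length w)) manipulation_program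
      (\<lambda>r. if r = 0 then w else []) = Some s' \<and> (hd0 (s' 26) = 0 \<longleftrightarrow> w \<in> borda_up_manipulation)"
    by (rule run_manipulation_program) (simp add: distrib_left)
qed simp_all

end
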